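(* If $\ell:X^N\to\mathbb R$ is upper semi-continuous and $\ell\in\mathcal G^<_{c^N}(X^N)$, then $$\sup_{\bar P\in\mathcal U_\infty}\mathbb E_{\bar P}\ell=\inf_{M\ge N}U^{\mathrm{sym}}_M(\ell),\qquad\text{where }\mathcal U_\infty=\bigcap_{M\ge N}\mathcal U_M.$$
   Context: $X$ nonempty Polish; $c$ a proper transportation cost (lower semi-continuous, symmetric, $c(x,x)=0$, weak triangle inequality, compact sublevel sets $\{x:c(x_0,x)\le r\}$); $\hat P$ a Borel probability measure with finite $c$-moment; $\rho>0$; $N\in\mathbb N$. For $M\ge N$: $c^M(x,y)=\sum_{i\le M}c(x_i,y_i)$; $\mathbb B^{c^M}_{M\rho}(\hat P^{\otimes M})$ is the set of Borel probability measures on $X^M$ with finite $c^M$-moment and $W_{c^M}(\cdot,\hat P^{\otimes M})\le M\rho$ ($W$ = optimal transport cost); the subscript $\mathrm{sym}$ on this set means intersection with permutation-invariant measures; $\mathcal U_M=\{(\mathrm{pr}^M_{1:N})_\#\bar P:\bar P\in\mathbb B^{c^M}_{M\rho}(\hat P^{\otimes M})_{\mathrm{sym}}\}$ with $\mathrm{pr}^M_{1:N}$ the projection onto the first $N$ coordinates; $U^{\mathrm{sym}}_M(\ell)=\sup_{\bar P\in\mathbb B^{c^M}_{M\rho}(\hat P^{\otimes M})}\mathbb E_{\bar P}(\ell\circ\mathrm{pr}^M_{1:N})_{\mathrm{sym}}$ where $g_{\mathrm{sym}}=\frac1{M!}\sum_{\pi\in\mathcal S_M}g\circ\pi$. $\mathcal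 D$: functions $\delta:[0,\infty)\to[0,\infty)$ with $\delta(r)\le r$, $\delta(r)/r\to0$; $\mathcal G^<_{c^N}(X^N)=\{\ell:\exists C>0,\delta\in\mathcal D,\hat x\in X^N,\ \ell\le C(1+\delta(c^N(\hat x,\cdot)))\}$. *)

theory Defs
  imports "HOL-Analysis.Analysis" "HOL-Probability.Probability"
begin

text \<open>Points of X^M are represented as extensional functions on the index set
  {..<M}, i.e. elements of the space of the product measure space
  PiM {..<M} (\<lambda>_. borel).\<close>

abbreviation prodX :: "nat \<Rightarrow> (nat \<Rightarrow> 'a::topological_space) measure" where
  "prodX M \<equiv> PiM {..<M} (\<lambda>_. borel)"

abbreviation prodTop :: "nat \<Rightarrow> (nat \<Rightarrow> 'a::topological_space) topology" where
  "prodTop M \<equiv> product_topology (\<lambda>_. euclidean) {..<M}"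

definition lsc :: "('b::topological_space \<Rightarrow> real) \<Rightarrow> bool" where
  "lsc f \<longleftrightarrow> (\<forall>a. open {x. f x > a})"

definition usc_on :: "'b topology \<Rightarrow> ('b \<Rightarrow> real) \<Rightarrow> bool" where
  "usc_on T f \<longleftrightarrow> (\<forall>a. openin T {x \<in> topspace T. f x < a})"

definition proper_cost :: "('a::topological_space \<Rightarrow> 'a \<Rightarrow> real) \<Rightarrow> bool" where
  "proper_cost c \<longleftrightarrow>
     lsc (\<lambda>z. c (fst z) (snd z)) \<and>
     (\<forall>x y. c x y = c y x) \<and>
     (\<forall>x. c x x = 0) \<and>
     (\<exists>C\<ge>1. \<forall>x y z. c x z \<le> C * (c x y + c y z)) \<and>
     (\<forall>x0 r. compact {x. c x0 x \<le> r})"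

definition costM :: "('a \<Rightarrow> 'a \<Rightarrow> real) \<Rightarrow> nat \<Rightarrow> (nat \<Rightarrow> 'a) \<Rightarrow> (nat \<Rightarrow> 'a) \<Rightarrow> real" where
  "costM c M x y = (\<Sum>i<M. c (x i) (y i))"

definition finite_moment :: "('b \<Rightarrow> 'b \<Rightarrow> real) \<Rightarrow> 'b measure \<Rightarrow> bool" where
  "finite_moment c P \<longleftrightarrow> (\<exists>x0\<in>space P. (\<integral>\<^sup>+ x. ennreal (c x0 x) \<partial>P) < \<infinity>)"

definition couplings :: "'b measure \<Rightarrow> 'b measure \<Rightarrow> ('b \<times> 'b) measure set" where
  "couplings P Q = {\<pi>. sets \<pi> = sets (P \<Otimes>\<^sub>M Q) \<and> prob_space \<pi> \<and>
                        distr \<pi> P fst = P \<and> distr \<pi> Q snd = Q}"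

definition OT :: "('b \<Rightarrow> 'b \<Rightarrow> real) \<Rightarrow> 'b measure \<Rightarrow> 'b measure \<Rightarrow> ennreal" where
  "OT c P Q = (INF \<pi>\<in>couplings P Q. \<integral>\<^sup>+ z. ennreal (c (fst z) (snd z)) \<partial>\<pi>)"

definition expect :: "'b measure \<Rightarrow> ('b \<Rightarrow> real) \<Rightarrow> ereal" where
  "expect P f = enn2ereal (\<integral>\<^sup>+ x. ennreal (f x) \<partial>P) - enn2ereal (\<integral>\<^sup>+ x. ennreal (- f x) \<partial>P)"

definition wball :: "('a::topological_space \<Rightarrow> 'a \<Rightarrow> real) \<Rightarrow> 'a measure \<Rightarrow> real \<Rightarrow> nat
                       \<Rightarrow> (nat \<Rightarrow> 'a) measure set" where
  "wball c Phat \<rho> M = {Pb. sets Pb = sets (prodX M) \<and> prob_space Pb \<and>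
       finite_moment (costM c M) Pb \<and>
       OT (costM c M) Pb (PiM {..<M} (\<lambda>_. Phat)) \<le> ennreal (real M * \<rho>)}"

definition perm_invariant :: "nat \<Rightarrow> (nat \<Rightarrow> 'a::topological_space) measure \<Rightarrow> bool" where
  "perm_invariant M Pb \<longleftrightarrow>
     (\<forall>\<sigma>. \<sigma> permutes {..<M} \<longrightarrow> distr Pb (prodX M) (\<lambda>x. x \<circ> \<sigma>) = Pb)"

definition wball_sym :: "('a::topological_space \<Rightarrow> 'a \<Rightarrow> real) \<Rightarrow> 'a measure \<Rightarrow> real \<Rightarrow> nat
                       \<Rightarrow> (nat \<Rightarrow> 'a) measure set" where
  "wball_sym c Phat \<rho> M = {Pb \<in> wball c Phat \<rho> M. perm_invariant M Pb}"

definition proj :: "nat \<Rightarrow> (nat \<Rightarrow> 'a) \<Rightarrow> (nat \<Rightarrow> 'a)" where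
  "proj N x = restrict x {..<N}"

definition UM :: "('a::topological_space \<Rightarrow> 'a \<Rightarrow> real) \<Rightarrow> 'a measure \<Rightarrow> real \<Rightarrow> nat \<Rightarrow> nat
                   \<Rightarrow> (nat \<Rightarrow> 'a) measure set" where
  "UM c Phat \<rho> N M = (\<lambda>Pb. distr Pb (prodX N) (proj N)) ` wball_sym c Phat \<rho> M"

definition Uinf :: "('a::topological_space \<Rightarrow> 'a \<Rightarrow> real) \<Rightarrow> 'a measure \<Rightarrow> real \<Rightarrow> nat
                   \<Rightarrow> (nat \<Rightarrow> 'a) measure set" where
  "Uinf c Phat \<rho> N = (\<Inter>M\<in>{N..}. UM c Phat \<rho> N M)"

definition symz :: "nat \<Rightarrow> ((nat \<Rightarrow> 'a) \<Rightarrow> real) \<Rightarrow> (nat \<Rightarrow> 'a) \<Rightarrow> real" where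
  "symz M g x = (\<Sum>\<sigma>\<in>{\<sigma>. \<sigma> permutes {..<M}}. g (x \<circ> \<sigma>)) / fact M"

definition Usym :: "('a::topological_space \<Rightarrow> 'a \<Rightarrow> real) \<Rightarrow> 'a measure \<Rightarrow> real \<Rightarrow> nat \<Rightarrow> nat
                   \<Rightarrow> ((nat \<Rightarrow> 'a) \<Rightarrow> real) \<Rightarrow> ereal" where
  "Usym c Phat \<rho> N M loss = (SUP Pb\<in>wball c Phat \<rho> M. expect Pb (symz M (loss \<circ> proj N)))"

definition gaugeD :: "(real \<Rightarrow> real) \<Rightarrow> bool" where
  "gaugeD \<delta> \<longleftrightarrow> (\<forall>r\<ge>0. 0 \<le> \<delta> r \<and> \<delta> r \<le> r) \<and> ((\<lambda>r. \<delta> r / r) \<longlongrightarrow> 0) at_top"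

definition growth_class :: "('a::topological_space \<Rightarrow> 'a \<Rightarrow> real) \<Rightarrow> nat \<Rightarrow> ((nat \<Rightarrow> 'a) \<Rightarrow> real) set" where
  "growth_class c N = {loss. \<exists>C>0. \<exists>\<delta>. gaugeD \<delta> \<and> (\<exists>xh\<in>topspace (prodTop N).
       \<forall>x\<in>topspace (prodTop N). loss x \<le> C * (1 + \<delta> (costM c N xh x)))}"

end

(*
Idea. The inequality "<=" holds because a permutation-invariant law does not see the
symmetrization of the loss.  For ">=" let a be below every U^sym_M.  For each M take a law P_M in
the ball with E_{P_M} (loss o pr)_sym > a, couple it with the M-fold product of Phat at cost at
most M rho + 1, and average the coupling over simultaneous permutations of both blocks of
coordinates.  By exchangeability each coordinate pair then costs at most rho + 1/M.  Pad the
averaged couplings to laws on (X x X)^nat.  Sublevel sets of c are compact, so these laws are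
tight, and a limit law R exists.  Exchangeability, the product second marginal and the cost bound
rho per coordinate pass to R, hence the first K coordinates of R lie in the symmetric ball for
every K at once and the first N of them form an element of U_infinity.  The sublinear growth makes
D + eps c^N - loss a nonnegative lower semi-continuous function for every eps > 0, so Fatou along
the limit gives E_R loss >= a.

Limits are taken along a filter on which the measures of all sets converge simultaneously
(Tychonoff); the limit law is the metric outer measure generated by the limits of the measures of
the open sets, so no Riesz representation or Kolmogorov extension is needed.
*)
theory Submission
  imports Defs
begin

section \<open>Limits of tight sequences of probability measures\<close>

text \<open>Projecting a law of the ball in dimension \<open>M\<close> to \<open>K\<close>
  coordinates may leave the ball of dimension \<open>K\<close>, because the budget
  \<open>M * \<rho>\<close> can be spent on few coordinates. Averaging removes this obstacle: any
  \<open>K\<close> of the \<open>M\<close> coordinate pairs then carry exactly the fraction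
  \<open>K / M\<close> of the cost. \<open>Uinf\<close> allows a different symmetric extension for
  every \<open>M\<close>; one law on the sequence space supplies them all consistently. Equalities
  such as exchangeability pass to the limit through uniqueness: both sides are limits of the same
  laws along the same filter. Only an inequality for open sets is recorded about limits, but bounds
  for two disjoint open sets squeeze any two limits together. The ball does not bound the moments of
  the first block directly. They come from the moment of \<open>Phat\<close> and the coupling cost
  through the weak triangle inequality. The loss is unbounded above, so semi-continuity alone would
  not survive the limit. The margin of \<epsilon> times the cost has an integral bounded uniformly
  in \<open>M\<close> and is given back as \<epsilon> tends to 0.\<close>

lemma compact_refine_filter:
  fixes q :: "nat \<Rightarrow> 'b::topological_space"
  assumes "compact S" and q: "\<And>n. q n \<in> S"
  obtains F l where "F \<noteq> bot" "F \<le> sequentially" "(q \<longlongrightarrow> l) F"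
proof -
  have "filtermap q sequentially \<noteq> bot"
    by (simp add: filtermap_bot_iff)
  moreover have "eventually (\<lambda>x. x \<in> S) (filtermap q sequentially)"
    using q by (simp add: eventually_filtermap)
  ultimately obtain l where l: "inf (nhds l) (filtermap q sequentially) \<noteq> bot"
    using \<open>compact S\<close> unfolding compact_filter by meson
  \<comment> \<open>\<open>F\<close> is nontrivial because every neighbourhood of the cluster point
    \<open>l\<close> contains \<open>q n\<close> for arbitrarily large \<open>n\<close>; the comap
    forces \<open>q\<close> to converge to \<open>l\<close> along \<open>F\<close>.\<close>
  define F where "F = inf sequentially (filtercomap q (nhds l))"
  have "F \<noteq> bot"
  proof
    assume "F = bot"
    then have "eventually (\<lambda>_. False) F"
      by simp
    then obtain P Q where PQ: "eventually P sequentially" "eventually Q (filtercomap q (nhds l))"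
      and no: "\<And>n. P n \<Longrightarrow> Q n \<Longrightarrow> False"
      unfolding F_def eventually_inf by auto
    then obtain Q' where Q': "eventually Q' (nhds l)" "\<And>n. Q' (q n) \<Longrightarrow> Q n"
      unfolding eventually_filtercomap by auto
    have "eventually (\<lambda>x. \<exists>n. x = q n \<and> P n) (filtermap q sequentially)"
      using PQ(1) by (auto simp: eventually_filtermap elim!: eventually_mono)
    then have "eventually (\<lambda>_. False) (inf (nhds l) (filtermap q sequentially))"
      unfolding eventually_inf using Q' no by (intro exI[of _ Q'] exI conjI) auto
    with l show False
      by (simp add: trivial_limit_def)
  qed
  moreover have "F \<le> sequentially"
    by (simp add: F_def)
  moreover have "(q \<longlongrightarrow> l) F"
    unfolding filterlim_iff_le_filtercomap F_def by simp
  ultimately show ?thesis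
    using that by blast
qed

text \<open>Tychonoff for the cube of functions from \<open>'i\<close> to the unit interval, where
  convergence is coordinatewise. Later \<open>'i\<close> is the type of all subsets of a space; such
  a cube is in general not sequentially compact, so a filter takes the place of a
  subsequence.\<close>

lemma setwise_convergent_refinement:
  fixes q :: "nat \<Rightarrow> 'i \<Rightarrow> real"
  assumes "\<And>n A. q n A \<in> {0..1}"
  obtains F l where "F \<noteq> bot" "F \<le> sequentially" "\<And>A. ((\<lambda>n. q n A) \<longlongrightarrow> l A) F"
proof -
  have "compact (PiE UNIV (\<lambda>_::'i. {0..1::real}))"
    using compactin_PiE[of "\<lambda>_::'i. euclidean::real topology" UNIV "\<lambda>_. {0..1::real}"]
    by (simp add: euclidean_product_topology)
  moreover have "q n \<in> PiE UNIV (\<lambda>_::'i. {0..1::real})" for n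
    using assms by auto
  ultimately obtain F l where Fl: "F \<noteq> bot" "F \<le> sequentially" "(q \<longlongrightarrow> l) F"
    using compact_refine_filter by metis
  have "((\<lambda>n. q n A) \<longlongrightarrow> l A) F" for A
  proof -
    have "open ((\<lambda>x. x A) -` V)" if "open V" for V :: "real set"
      using that by (intro open_vimage continuous_on_product_coordinates)
    then show ?thesis
      using topological_tendstoD[OF Fl(3)] by (intro topological_tendstoI) fastforce
  qed
  with Fl that show ?thesis by blast
qed

section \<open>Metric outer measures and Caratheodory's criterion\<close>

text \<open>The function \<open>d\<close> is 1-Lipschitz and the layers
  \<open>a k < d \<le> b k\<close> leave gaps, so each \<open>D n\<close> has positive distance from
  all earlier ones together and can be split off the union. It is applied to the even and to the odd
  shells of an open set.\<close>

lemma metric_outer_measure_separated_sum: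
  fixes \<phi> :: "'b::metric_space set \<Rightarrow> ennreal" and D :: "nat \<Rightarrow> 'b set" and d :: "'b \<Rightarrow> real"
  assumes inc: "\<And>A B. A \<subseteq> B \<Longrightarrow> \<phi> A \<le> \<phi> B"
    and sep: "\<And>A B e. e > 0 \<Longrightarrow> (\<And>x y. x \<in> A \<Longrightarrow> y \<in> B \<Longrightarrow> e \<le> dist x y) \<Longrightarrow> \<phi> A + \<phi> B \<le> \<phi> (A \<union> B)"
    and lip: "\<And>x y. \<bar>d x - d y\<bar> \<le> dist x y"
    and lo: "\<And>k x. x \<in> D k \<Longrightarrow> a k < d x" and hi: "\<And>k x. x \<in> D k \<Longrightarrow> d x \<le> b k"
    and ab: "\<And>k l. k < l \<Longrightarrow> b l < a k" and sub: "\<And>k. D k \<subseteq> A" and a: "decseq a"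
  shows "(\<Sum>k<n. \<phi> (D k)) \<le> \<phi> A"
proof -
  have "(\<Sum>k<n. \<phi> (D k)) \<le> \<phi> (\<Union>k<n. D k)"
  proof (induction n)
    case (Suc n)
    have "\<phi> (\<Union>k<n. D k) + \<phi> (D n) \<le> \<phi> ((\<Union>k<n. D k) \<union> D n)"
    proof (cases "n = 0")
      case True
      then show ?thesis
        using sep[of 1 "{}" "D 0"] by simp
    next
      case False
      \<comment> \<open>Points of earlier layers have \<open>d\<close> above
        \<open>a (n - 1)\<close> because \<open>a\<close> decreases; on \<open>D n\<close> it is at
        most \<open>b n\<close>.\<close>
      show ?thesis
      proof (rule sep[of "a (n - 1) - b n"])
        show "0 < a (n - 1) - b n"
          using ab[of "n - 1" n] False by simp
        fix x y assume x: "x \<in> (\<Union>k<n. D k)" and y: "y \<in> D n"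
        then obtain k where "k < n" "x \<in> D k" by auto
        then have "a (n - 1) < d x"
          using lo[of x k] decseqD[OF a, of k "n - 1"] by force
        with hi[OF y] lip[of x y] show "a (n - 1) - b n \<le> dist x y"
          by linarith
      qed
    qed
    with Suc show ?case
      by (simp add: lessThan_Suc Un_commute add.commute) (metis add_left_mono order_trans)
  qed (simp)
  also have "\<dots> \<le> \<phi> A"
    using sub by (intro inc) auto
  finally show ?thesis .
qed

text \<open>Caratheodory's criterion. The part \<open>S n\<close> of \<open>A\<close> at depth more
  than \<open>u n\<close> inside \<open>G\<close> is separated from \<open>A - G\<close>, so
  \<open>\<phi>\<close> adds up on these two; what \<open>S n\<close> misses of
  \<open>A \<inter> G\<close> lies in shells whose total mass \<open>t n\<close> vanishes.\<close>

lemma metric_outer_measure_open_split: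
  fixes \<phi> :: "'b::metric_space set \<Rightarrow> ennreal"
  assumes inc: "\<And>A B. A \<subseteq> B \<Longrightarrow> \<phi> A \<le> \<phi> B"
    and csub: "\<And>A::nat \<Rightarrow> 'b set. \<phi> (\<Union>i. A i) \<le> (\<Sum>i. \<phi> (A i))"
    and sub2: "\<And>A B. \<phi> (A \<union> B) \<le> \<phi> A + \<phi> B"
    and fin: "\<phi> UNIV < \<infinity>"
    and sep: "\<And>A B e. e > 0 \<Longrightarrow> (\<And>x y. x \<in> A \<Longrightarrow> y \<in> B \<Longrightarrow> e \<le> dist x y) \<Longrightarrow> \<phi> A + \<phi> B \<le> \<phi> (A \<union> B)"
    and G: "open G"
  shows "\<phi> (A \<inter> G) + \<phi> (A - G) \<le> \<phi> A"
proof (cases "G = UNIV")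
  \<comment> \<open>The distance to the empty set is 0 by convention, so \<open>d\<close> could not
    recognise \<open>G = UNIV\<close>.\<close>
  case True
  then show ?thesis
    using sep[of 1 A "{}"] by simp
next
  case False
  define d where "d x = infdist x (- G)" for x
  have lip: "\<bar>d x - d y\<bar> \<le> dist x y" for x y
    unfolding d_def by (rule infdist_triangle_abs)
  have d0: "d x = 0 \<longleftrightarrow> x \<notin> G" for x
    using in_closed_iff_infdist_zero[of "- G" x] G False by (auto simp: d_def closed_Compl)
  have dnn: "0 \<le> d x" for x
    by (simp add: d_def infdist_nonneg)
  define u :: "nat \<Rightarrow> real" where "u n = 1 / (real n + 1)" for n
  have u_less: "u m < u n" if "n < m" for m n
    using that by (auto simp: u_def field_simps)
  have u_pos: "0 < u n" for n
    by (simp add: u_def)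
  define S where "S n = {x \<in> A. u n < d x}" for n
  \<comment> \<open>The shells \<open>D k\<close> with indices of equal parity are pairwise at positive distance, so
    \<open>\<Sum>k. \<phi> (D k) \<le> 2 * \<phi> A < \<infinity>\<close> and the tails of this series vanish.\<close>
  define D where "D k = {x \<in> A. u (Suc k) < d x \<and> d x \<le> u k}" for k
  have "(\<Sum>k<n. \<phi> (D (2 * k))) \<le> \<phi> A" for n
  proof (rule metric_outer_measure_separated_sum[OF inc sep lip,
      where a = "\<lambda>k. u (Suc (2 * k))" and b = "\<lambda>k. u (2 * k)"])
    show "decseq (\<lambda>k. u (Suc (2 * k)))"
      by (intro decseq_SucI less_imp_le u_less) simp
  qed (auto simp: D_def intro: u_less)
  then have ev: "(\<Sum>k. \<phi> (D (2 * k))) \<le> \<phi> A"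
    by (intro suminf_le_const) auto
  have "(\<Sum>k<n. \<phi> (D (Suc (2 * k)))) \<le> \<phi> A" for n
  proof (rule metric_outer_measure_separated_sum[OF inc sep lip,
      where a = "\<lambda>k. u (Suc (Suc (2 * k)))" and b = "\<lambda>k. u (Suc (2 * k))"])
    show "decseq (\<lambda>k. u (Suc (Suc (2 * k))))"
      by (intro decseq_SucI less_imp_le u_less) simp
  qed (auto simp: D_def intro: u_less)
  then have od: "(\<Sum>k. \<phi> (D (Suc (2 * k)))) \<le> \<phi> A"
    by (intro suminf_le_const) auto
  have fin': "\<phi> B < \<infinity>" for B
    using inc[of B UNIV] fin by auto
  define f where "f k = enn2real (\<phi> (D k))" for k
  have f: "\<phi> (D k) = ennreal (f k)" and f0: "0 \<le> f k" for k
    using fin'[of "D k"] by (simp_all add: f_def ennreal_enn2real)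
  have "(\<Sum>k<n. f k) \<le> 2 * enn2real (\<phi> A)" for n
  proof -
    have "(\<Sum>k<2 * n. f k) = (\<Sum>k<n. f (2 * k)) + (\<Sum>k<n. f (Suc (2 * k)))"
      by (induction n) auto
    then have "ennreal (\<Sum>k<n. f k) \<le> ennreal ((\<Sum>k<n. f (2 * k)) + (\<Sum>k<n. f (Suc (2 * k))))"
      using sum_mono2[of "{..<2 * n}" "{..<n}" f] f0 by (intro ennreal_leI) auto
    also have "\<dots> = (\<Sum>k<n. \<phi> (D (2 * k))) + (\<Sum>k<n. \<phi> (D (Suc (2 * k))))"
      by (simp add: f f0 sum_nonneg)
    also have "\<dots> \<le> \<phi> A + \<phi> A"
      by (intro add_mono order_trans[OF sum_le_suminf ev] order_trans[OF sum_le_suminf od]) auto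
    also have "\<dots> = ennreal (enn2real (\<phi> A)) + ennreal (enn2real (\<phi> A))"
      using fin'[of A] by (simp add: ennreal_enn2real)
    also have "\<dots> = ennreal (2 * enn2real (\<phi> A))"
      by (subst ennreal_plus[symmetric]) auto
    finally show ?thesis
      by (simp add: ennreal_le_iff)
  qed
  then have summ: "summable f"
    by (intro bounded_imp_summable[OF f0, where B = "2 * enn2real (\<phi> A)"]) (metis lessThan_Suc_atMost)
  define t where "t n = (\<Sum>k. f (k + n))" for n
  have t: "t \<longlonglongrightarrow> 0"
    using summ unfolding t_def by (rule suminf_exist_split2)
  have "\<phi> (A \<inter> G) + \<phi> (A - G) \<le> \<phi> A + ennreal (t n)" for n
  proof -
    have "A \<inter> G \<subseteq> S n \<union> (\<Union>k. D (k + n))"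
    proof
      fix x assume x: "x \<in> A \<inter> G"
      then have "0 < d x"
        using d0[of x] dnn[of x] by (auto simp: less_le)
      then obtain m where "inverse (real (Suc m)) < d x"
        using reals_Archimedean by blast
      then have m: "u m < d x"
        by (simp add: u_def field_simps)
      show "x \<in> S n \<union> (\<Union>k. D (k + n))"
      proof (cases "u n < d x")
        case True
        with x show ?thesis by (simp add: S_def)
      next
        case False
        \<comment> \<open>With \<open>j\<close> the first index such that \<open>u j < d x\<close>,
          the point lies in the shell of index \<open>j - 1\<close>, and
          \<open>d x \<le> u n\<close> forces \<open>n \<le> j - 1\<close>.\<close>
        define j where "j = (LEAST j. u j < d x)"
        have j: "u j < d x" and jl: "\<And>i. i < j \<Longrightarrow> \<not> u i < d x"
          unfolding j_def using m by (auto intro: LeastI dest: not_less_Least)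
        have "n < j"
        proof (rule ccontr)
          assume "\<not> n < j"
          then have "u n \<le> u j"
            using u_less[of j n] by (cases "j = n") auto
          with j False show False by simp
        qed
        then have "x \<in> D ((j - 1 - n) + n)"
          using j jl[of "j - 1"] x by (auto simp: D_def not_less)
        then show ?thesis by blast
      qed
    qed
    then have "\<phi> (A \<inter> G) \<le> \<phi> (S n) + (\<Sum>k. \<phi> (D (k + n)))"
      by (intro order_trans[OF inc order_trans[OF sub2 add_left_mono[OF csub]]])
    also have "(\<Sum>k. \<phi> (D (k + n))) = ennreal (t n)"
      unfolding f t_def using summ f0
      by (intro suminf_ennreal2) (auto simp: summable_iff_shift)
    finally have "\<phi> (A \<inter> G) + \<phi> (A - G) \<le> (\<phi> (S n) + \<phi> (A - G)) + ennreal (t n)"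
      by (metis add.commute add.left_commute add_left_mono)
    also have "\<phi> (S n) + \<phi> (A - G) \<le> \<phi> (S n \<union> (A - G))"
    proof (rule sep[OF u_pos[of n]])
      fix x y assume "x \<in> S n" "y \<in> A - G"
      then show "u n \<le> dist x y"
        using d0[of y] lip[of x y] by (auto simp: S_def)
    qed
    also have "\<dots> \<le> \<phi> A"
      by (rule inc) (auto simp: S_def)
    finally show ?thesis
      by (simp add: add_right_mono)
  qed
  moreover have "(\<lambda>n. \<phi> A + ennreal (t n)) \<longlonglongrightarrow> \<phi> A + ennreal 0"
    by (intro tendsto_add tendsto_const tendsto_ennrealI t)
  ultimately show ?thesis
    using LIMSEQ_le_const[of "\<lambda>n. \<phi> A + ennreal (t n)"] by (metis add_0_right ennreal_0)
qed

text \<open>The sets that split every set additively form a sigma-algebra on which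
  \<open>\<phi>\<close> is a measure; by superadditivity on separated sets it contains every open
  set, hence every Borel set.\<close>

lemma metric_outer_measure_borel:
  fixes \<phi> :: "'b::metric_space set \<Rightarrow> ennreal"
  assumes emp: "\<phi> {} = 0" and inc: "\<And>A B. A \<subseteq> B \<Longrightarrow> \<phi> A \<le> \<phi> B"
    and csub: "\<And>A::nat \<Rightarrow> 'b set. \<phi> (\<Union>i. A i) \<le> (\<Sum>i. \<phi> (A i))"
    and fin: "\<phi> UNIV < \<infinity>"
    and sep: "\<And>A B e. e > 0 \<Longrightarrow> (\<And>x y. x \<in> A \<Longrightarrow> y \<in> B \<Longrightarrow> e \<le> dist x y) \<Longrightarrow> \<phi> A + \<phi> B \<le> \<phi> (A \<union> B)"
  shows "measure_space UNIV (sets borel) \<phi>"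
proof -
  interpret sigma_algebra UNIV "Pow (UNIV :: 'b set)"
    by (rule sigma_algebra_Pow)
  have oms: "outer_measure_space (Pow UNIV) \<phi>"
    using emp inc csub
    by (auto simp: outer_measure_space_def positive_def increasing_def countably_subadditive_def)
  then have "subadditive (Pow UNIV) \<phi>"
    by (auto simp: outer_measure_space_def simp del: Pow_UNIV intro: countably_subadditive_subadditive)
  \<comment> \<open>\<open>subadditive\<close> speaks of disjoint sets, hence the detour over
    \<open>B - A\<close>.\<close>
  have sub2: "\<phi> (A \<union> B) \<le> \<phi> A + \<phi> B" for A B
  proof -
    have "\<phi> (A \<union> B) \<le> \<phi> (A \<union> (B - A))"
      by (rule inc) auto
    also have "\<dots> \<le> \<phi> A + \<phi> (B - A)"
      using \<open>subadditive (Pow UNIV) \<phi>\<close> unfolding subadditive_def by blast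
    also have "\<dots> \<le> \<phi> A + \<phi> B"
      by (intro add_left_mono inc) auto
    finally show ?thesis .
  qed
  have ms: "measure_space UNIV (lambda_system UNIV (Pow UNIV) \<phi>) \<phi>"
    by (rule caratheodory_lemma[OF oms])
  have "G \<in> lambda_system UNIV (Pow UNIV) \<phi>" if "open G" for G
  proof -
    have "\<phi> (A \<inter> G) + \<phi> (A - G) = \<phi> A" for A
    proof (rule antisym)
      show "\<phi> (A \<inter> G) + \<phi> (A - G) \<le> \<phi> A"
        by (rule metric_outer_measure_open_split[OF inc csub sub2 fin sep that])
      show "\<phi> A \<le> \<phi> (A \<inter> G) + \<phi> (A - G)"
        using sub2[of "A \<inter> G" "A - G"] by (simp add: Int_Diff_Un)
    qed
    then show ?thesis
      unfolding lambda_system_eq by blast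
  qed
  moreover have "sigma_algebra UNIV (lambda_system UNIV (Pow UNIV) \<phi>)"
    using ms by (simp add: measure_space_def)
  ultimately have "sets borel \<subseteq> lambda_system UNIV (Pow UNIV) \<phi>"
    unfolding borel_def by (auto dest!: subsetD[OF sigma_algebra.sigma_sets_subset, rotated 2])
  with ms show ?thesis
    using measure_down sets.sigma_algebra_axioms[of borel] by (metis space_borel)
qed


section \<open>Limit laws along a filter: existence, uniqueness, images\<close>

text \<open>The defining property is the portmanteau inequality for open sets, with the limits
  \<open>l A\<close> required for all sets \<open>A\<close> (measure \<open>0\<close> off the sigma-algebra).\<close>

definition limit_measure :: "nat filter \<Rightarrow> (nat \<Rightarrow> 'b::topological_space measure) \<Rightarrow> 'b measure \<Rightarrow> bool" where
  "limit_measure F Q R \<longleftrightarrow> F \<noteq> bot \<and> prob_space R \<and> sets R = sets borel \<and>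
     (\<exists>l. \<forall>A. ((\<lambda>n. measure (Q n) A) \<longlongrightarrow> l A) F \<and> (open A \<longrightarrow> measure R A \<le> l A))"

text \<open>Covers of the sets \<open>A n\<close> that are optimal up to \<open>e / 2^(n+1)\<close>
  are merged into a single cover, enumerated by \<open>prod_decode\<close>.\<close>

lemma countably_subadditive_cover_infimum:
  fixes l :: "'b set \<Rightarrow> ennreal" and \<A> :: "'b set set"
  defines "\<phi> \<equiv> \<lambda>A. INF G\<in>{G::nat \<Rightarrow> 'b set. range G \<subseteq> \<A> \<and> A \<subseteq> (\<Union>i. G i)}. \<Sum>i. l (G i)"
  shows "\<phi> (\<Union>i::nat. A i) \<le> (\<Sum>i. \<phi> (A i))"
proof (rule ennreal_le_epsilon)
  fix e :: real assume "0 < e" "(\<Sum>i. \<phi> (A i)) < top"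
  then have *: "\<phi> (A n) < \<phi> (A n) + e * (1/2)^Suc n" for n
    by (auto simp add: less_top dest!: ennreal_suminf_lessD)
  have "\<exists>G. range G \<subseteq> \<A> \<and> A n \<subseteq> (\<Union>i. G i) \<and> (\<Sum>i. l (G i)) \<le> \<phi> (A n) + e * (1/2)^Suc n" for n
    using *[of n] unfolding \<phi>_def INF_less_iff by (auto intro: less_imp_le)
  then obtain B :: "nat \<Rightarrow> nat \<Rightarrow> 'b set"
    where B: "\<And>n. range (B n) \<subseteq> \<A>" and AB: "\<And>n. A n \<subseteq> (\<Union>i. B n i)"
      and Ble: "\<And>n. (\<Sum>i. l (B n i)) \<le> \<phi> (A n) + e * (1/2)^Suc n"
    by metis
  define C where "C = case_prod B \<circ> prod_decode"
  have "range C \<subseteq> \<A>"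
    using B by (auto simp: C_def split_def)
  moreover have "(\<Union>i. A i) \<subseteq> (\<Union>i. C i)"
    using AB by (auto simp add: C_def subset_eq) (metis prod.case prod_encode_inverse)
  ultimately have "\<phi> (\<Union>i. A i) \<le> (\<Sum>i. l (C i))"
    unfolding \<phi>_def by (intro INF_lower) auto
  also have "\<dots> = (\<Sum>n. \<Sum>i. l (B n i))"
    unfolding C_def comp_def by (intro suminf_ennreal_2dimen) auto
  also have "\<dots> \<le> (\<Sum>n. \<phi> (A n) + e * (1/2) ^ Suc n)"
    by (intro suminf_le allI Ble) auto
  also have "\<dots> = (\<Sum>n. \<phi> (A n)) + (\<Sum>n. ennreal e * ennreal ((1/2) ^ Suc n))"
    using \<open>0 < e\<close> by (subst suminf_add[symmetric])
                     (auto simp del: ennreal_suminf_cmult simp add: ennreal_mult[symmetric])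
  also have "\<dots> = (\<Sum>n. \<phi> (A n)) + e"
    unfolding ennreal_suminf_cmult
    by (subst suminf_ennreal_eq[OF zero_le_power power_half_series]) auto
  finally show "\<phi> (\<Union>i. A i) \<le> (\<Sum>n. \<phi> (A n)) + e" .
qed

text \<open>The limit \<open>l\<close> of the measures is only finitely additive on Borel sets.
  Countable additivity is restored by the outer measure \<open>\<phi>\<close> of countable open
  covers; tightness keeps its total mass from dropping below 1.\<close>

lemma tight_imp_limit_measure:
  fixes Q :: "nat \<Rightarrow> 'b::metric_space measure"
  assumes prob: "\<And>n. prob_space (Q n)" and sets: "\<And>n. sets (Q n) = sets borel"
    and tight: "\<And>e. e > 0 \<Longrightarrow> \<exists>K. compact K \<and> (\<forall>n. 1 - e \<le> measure (Q n) K)"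
  shows "\<exists>F R. limit_measure F Q R \<and> F \<le> sequentially"
proof -
  have fin: "finite_measure (Q n)" for n
    using prob[of n] by (simp add: prob_space_def)
  have "measure (Q n) A \<in> {0..1}" for n A
    using prob_space.prob_le_1[OF prob] by simp
  then obtain F l where F: "F \<noteq> bot" "F \<le> sequentially"
    and l: "\<And>A. ((\<lambda>n. measure (Q n) A) \<longlongrightarrow> l A) F"
    using setwise_convergent_refinement[of "\<lambda>n A. measure (Q n) A"] by blast
  have l_mono: "l A \<le> l B" if "A \<subseteq> B" "B \<in> sets borel" for A B
    using that sets F(1) fin
    by (intro tendsto_le[OF F(1) l l] always_eventually allI finite_measure.finite_measure_mono) auto
  have l_nonneg: "0 \<le> l A" for A
    by (intro tendsto_lowerbound[OF l _ F(1)] always_eventually) auto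
  have l_Un: "l (A \<union> B) = l A + l B" if "A \<inter> B = {}" "A \<in> sets borel" "B \<in> sets borel" for A B
  proof -
    have "measure (Q n) (A \<union> B) = measure (Q n) A + measure (Q n) B" for n
      using that sets by (intro finite_measure.finite_measure_Union fin) auto
    then have "((\<lambda>n. measure (Q n) A + measure (Q n) B) \<longlongrightarrow> l (A \<union> B)) F"
      using l[of "A \<union> B"] by simp
    then show ?thesis
      using tendsto_unique[OF F(1) _ tendsto_add[OF l l]] by blast
  qed
  have l_empty: "l {} = 0"
    using tendsto_unique[OF F(1) l[of "{}"]] by simp
  have l_UNIV: "l UNIV = 1"
  proof -
    have "measure (Q n) UNIV = 1" for n
      using prob_space.prob_space[OF prob[of n]] sets_eq_imp_space_eq[OF sets[of n]] by simp
    then show ?thesis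
      using tendsto_unique[OF F(1) l[of UNIV]] by simp
  qed
  have l_finite: "l (\<Union>i<n. G i) \<le> (\<Sum>i<n. l (G i))" if "\<And>i. G i \<in> sets borel" for G and n :: nat
  proof (rule tendsto_le[OF F(1)])
    show "((\<lambda>m. \<Sum>i<n. measure (Q m) (G i)) \<longlongrightarrow> (\<Sum>i<n. l (G i))) F"
      by (intro tendsto_sum l)
    show "((\<lambda>m. measure (Q m) (\<Union>i<n. G i)) \<longlongrightarrow> l (\<Union>i<n. G i)) F"
      by (rule l)
    show "\<forall>\<^sub>F m in F. measure (Q m) (\<Union>i<n. G i) \<le> (\<Sum>i<n. measure (Q m) (G i))"
      using that sets
      by (intro always_eventually allI finite_measure.finite_measure_subadditive_finite fin) auto
  qed
  define \<phi> where "\<phi> A = (INF G\<in>{G::nat \<Rightarrow> 'b set. range G \<subseteq> Collect open \<and> A \<subseteq> (\<Union>i. G i)}. \<Sum>i. ennreal (l (G i)))" for A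
  have open_le: "\<phi> G \<le> ennreal (l G)" if "open G" for G
  proof -
    \<comment> \<open>The cover of \<open>G\<close> by itself and empty sets gives the portmanteau
      inequality.\<close>
    have "\<phi> G \<le> (\<Sum>i. ennreal (l (if i = 0 then G else {})))"
      unfolding \<phi>_def using that by (intro INF_lower) (auto split: if_splits)
    also have "\<dots> = ennreal (l G)"
      using l_empty by (subst suminf_finite[of "{0}"]) auto
    finally show ?thesis .
  qed
  have inc: "\<phi> A \<le> \<phi> B" if "A \<subseteq> B" for A B
    unfolding \<phi>_def using that by (intro INF_superset_mono) auto
  have csub: "\<phi> (\<Union>i. A i) \<le> (\<Sum>i. \<phi> (A i))" for A :: "nat \<Rightarrow> 'b set"
    unfolding \<phi>_def by (rule countably_subadditive_cover_infimum)
  have ms: "measure_space UNIV (sets borel) \<phi>"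
  proof (rule metric_outer_measure_borel[OF _ inc csub])
    show "\<phi> {} = 0"
      using open_le[of "{}"] l_empty by simp
    show "\<phi> UNIV < \<infinity>"
      using open_le[of UNIV] l_UNIV by (auto simp: less_top[symmetric] top_unique)
    fix A B :: "'b set" and e :: real
    assume e: "e > 0" and sep: "\<And>x y. x \<in> A \<Longrightarrow> y \<in> B \<Longrightarrow> e \<le> dist x y"
    \<comment> \<open>Cutting a cover of \<open>A \<union> B\<close> along the disjoint
      neighbourhoods \<open>U\<close> and \<open>V\<close> yields covers of \<open>A\<close> and of
      \<open>B\<close>, and finite additivity of \<open>l\<close> compares the sums.\<close>
    define U where "U = (\<Union>x\<in>A. ball x (e/2))"
    define V where "V = (\<Union>x\<in>B. ball x (e/2))"
    have UV: "open U" "open V" "A \<subseteq> U" "B \<subseteq> V"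
      using e by (auto simp: U_def V_def)
    have "U \<inter> V = {}"
    proof (rule ccontr)
      assume "U \<inter> V \<noteq> {}"
      then obtain x y z where "x \<in> A" "y \<in> B" "dist x z < e/2" "dist y z < e/2"
        by (auto simp: U_def V_def)
      then show False
        using sep[of x y] dist_triangle_half_r[of z x e y] by (simp add: dist_commute)
    qed
    show "\<phi> A + \<phi> B \<le> \<phi> (A \<union> B)"
      unfolding \<phi>_def[of "A \<union> B"]
    proof (rule INF_greatest)
      fix G :: "nat \<Rightarrow> 'b set" assume "G \<in> {G. range G \<subseteq> Collect open \<and> A \<union> B \<subseteq> (\<Union>i. G i)}"
      then have G: "\<And>i. open (G i)" "A \<union> B \<subseteq> (\<Union>i. G i)" by auto
      have "\<phi> A \<le> (\<Sum>i. ennreal (l (G i \<inter> U)))"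
        unfolding \<phi>_def using G UV by (intro INF_lower) auto
      moreover have "\<phi> B \<le> (\<Sum>i. ennreal (l (G i \<inter> V)))"
        unfolding \<phi>_def using G UV by (intro INF_lower) auto
      ultimately have "\<phi> A + \<phi> B \<le> (\<Sum>i. ennreal (l (G i \<inter> U))) + (\<Sum>i. ennreal (l (G i \<inter> V)))"
        by (rule add_mono)
      also have "\<dots> = (\<Sum>i. ennreal (l (G i \<inter> U)) + ennreal (l (G i \<inter> V)))"
        by (rule suminf_add) auto
      also have "\<dots> \<le> (\<Sum>i. ennreal (l (G i)))"
      proof (intro suminf_le)
        fix i
        have "l (G i \<inter> U) + l (G i \<inter> V) = l ((G i \<inter> U) \<union> (G i \<inter> V))"
          using \<open>U \<inter> V = {}\<close> G UV by (intro l_Un[symmetric]) auto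
        also have "\<dots> \<le> l (G i)"
          using G by (intro l_mono) auto
        finally show "ennreal (l (G i \<inter> U)) + ennreal (l (G i \<inter> V)) \<le> ennreal (l (G i))"
          using l_nonneg by (simp add: ennreal_leI flip: ennreal_plus)
      qed auto
      finally show "\<phi> A + \<phi> B \<le> (\<Sum>i. ennreal (l (G i)))" .
    qed
  qed
  have \<phi>1: "\<phi> UNIV = 1"
  proof (rule antisym)
    show "\<phi> UNIV \<le> 1"
      using open_le[of UNIV] l_UNIV by simp
    show "1 \<le> \<phi> UNIV"
      unfolding \<phi>_def
    proof (rule INF_greatest)
      fix G :: "nat \<Rightarrow> 'b set" assume "G \<in> {G. range G \<subseteq> Collect open \<and> UNIV \<subseteq> (\<Union>i. G i)}"
      then have G: "\<And>i. open (G i)" "(\<Union>i. G i) = UNIV" by auto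
      show "1 \<le> (\<Sum>i. ennreal (l (G i)))"
      proof (rule ennreal_le_epsilon)
        \<comment> \<open>A compact set of limit mass at least \<open>1 - e\<close> is covered by
          finitely many \<open>G i\<close>, where finite subadditivity of \<open>l\<close>
          suffices.\<close>
        fix e :: real assume "0 < e"
        then obtain K where K: "compact K" "\<And>n. 1 - e \<le> measure (Q n) K"
          using tight by blast
        obtain I where I: "finite I" "K \<subseteq> (\<Union>i\<in>I. G i)"
          using compactE_image[OF K(1), of UNIV G] G by auto
        then obtain n where "I \<subseteq> {..<n}"
          by (metis finite_nat_iff_bounded)
        have "1 - e \<le> l K"
          using K(2) by (intro tendsto_lowerbound[OF l _ F(1)]) auto
        also have "\<dots> \<le> l (\<Union>i<n. G i)"
          using order_trans[OF I(2) UN_mono[OF \<open>I \<subseteq> {..<n}\<close>]] G by (intro l_mono) auto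
        also have "\<dots> \<le> (\<Sum>i<n. l (G i))"
          using G by (intro l_finite) auto
        finally have "ennreal 1 \<le> ennreal ((\<Sum>i<n. l (G i)) + e)"
          by (intro ennreal_leI) simp
        also have "\<dots> = (\<Sum>i<n. ennreal (l (G i))) + ennreal e"
          using \<open>0 < e\<close> l_nonneg by (simp add: ennreal_plus sum_nonneg)
        also have "\<dots> \<le> (\<Sum>i. ennreal (l (G i))) + ennreal e"
          by (intro add_right_mono sum_le_suminf) auto
        finally show "1 \<le> (\<Sum>i. ennreal (l (G i))) + ennreal e" by simp
      qed
    qed
  qed
  define R where "R = measure_of UNIV (sets borel) \<phi>"
  have setsR: "sets R = sets borel"
    unfolding R_def by (metis sets.sets_measure_of_eq space_borel)
  have emR: "emeasure R A = \<phi> A" if "A \<in> sets borel" for A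
    unfolding R_def using ms that
    by (intro emeasure_measure_of_sigma) (auto simp: measure_space_def)
  have "prob_space R"
    using emR[of UNIV] \<phi>1 sets_eq_imp_space_eq[OF setsR] by (intro prob_spaceI) auto
  moreover have "measure R G \<le> l G" if "open G" for G
    using open_le[OF that] emR[of G] that l_nonneg[of G]
    by (simp add: measure_def enn2real_leI)
  ultimately have "limit_measure F Q R"
    unfolding limit_measure_def using F l setsR by blast
  with F(2) show ?thesis by blast
qed

text \<open>Outer regularity extends the inequality from open to Borel sets; applied to a set and to
  its complement, it becomes an equality since both total masses are 1.\<close>

lemma prob_measure_eqI_open_le:
  fixes R R' :: "'b::{second_countable_topology, complete_space} measure"
  assumes R: "prob_space R" "sets R = sets borel" and R': "prob_space R'" "sets R' = sets borel"
    and le: "\<And>G. open G \<Longrightarrow> measure R G \<le> measure R' G"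
  shows "R = R'"
proof -
  interpret R: prob_space R by fact
  interpret R': prob_space R' by fact
  have sp: "space R = UNIV" "space R' = UNIV"
    using sets_eq_imp_space_eq[OF R(2)] sets_eq_imp_space_eq[OF R'(2)] by auto
  have *: "measure R A \<le> measure R' A" if A: "A \<in> sets borel" for A
  proof -
    have "emeasure R A \<le> (INF U\<in>{U. A \<subseteq> U \<and> open U}. emeasure R' U)"
    proof (rule INF_greatest)
      fix U assume "U \<in> {U. A \<subseteq> U \<and> open U}"
      then have "emeasure R A \<le> emeasure R U" "emeasure R U \<le> emeasure R' U"
        using R(2) le[of U]
        by (auto intro!: emeasure_mono simp: R'.emeasure_eq_measure simp flip: R.emeasure_eq_measure)
           (simp add: R.emeasure_eq_measure)
      then show "emeasure R A \<le> emeasure R' U" by (rule order_trans)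
    qed
    also have "\<dots> = emeasure R' A"
      using A by (intro outer_regular[symmetric] R') auto
    finally show ?thesis
      by (simp add: R.emeasure_eq_measure R'.emeasure_eq_measure)
  qed
  show ?thesis
  proof (rule measure_eqI)
    fix A assume "A \<in> sets R"
    then have A: "A \<in> sets borel" "- A \<in> sets borel" "A \<in> sets R" "A \<in> sets R'"
      using R R' by auto
    then have "measure R A = measure R' A"
      using *[OF A(1)] *[OF A(2)] R.prob_compl[OF A(3)] R'.prob_compl[OF A(4)]
      by (simp add: sp Compl_eq_Diff_UNIV)
    then show "emeasure R A = emeasure R' A"
      by (simp add: R.emeasure_eq_measure R'.emeasure_eq_measure)
  qed (simp add: R R')
qed

text \<open>An open \<open>G\<close> is exhausted by the sets \<open>H n\<close>. The
  \<open>R\<close>-mass of \<open>H n\<close> is bounded by its limit mass, and this by one minus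
  the limit mass of a disjoint open set \<open>E\<close>, to which the open-set bound for
  \<open>R'\<close> applies.\<close>

lemma limit_measure_unique:
  fixes R R' :: "'b::{second_countable_topology, complete_space} measure"
  assumes R: "limit_measure F Q R" and R': "limit_measure F Q R'"
    and Q: "\<And>n. prob_space (Q n)" "\<And>n. sets (Q n) = sets borel"
  shows "R = R'"
proof -
  have dom: "measure R G \<le> measure R' G"
    if lims: "limit_measure F Q R" "limit_measure F Q R'" and "open G" for R R' :: "'b measure" and G
  proof (cases "G = UNIV")
    case True
    then have "measure R' G = 1"
      using lims sets_eq_imp_space_eq[of R' borel] prob_space.prob_space[of R']
      by (auto simp: limit_measure_def)
    then show ?thesis
      using lims(1) by (simp add: limit_measure_def prob_space.prob_le_1)
  next
    case False
    obtain l where F: "F \<noteq> bot" and l: "\<And>A. ((\<lambda>n. measure (Q n) A) \<longlongrightarrow> l A) F"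
      and lR: "\<And>A. open A \<Longrightarrow> measure R A \<le> l A"
      using lims(1) unfolding limit_measure_def by blast
    obtain l' where l': "\<And>A. ((\<lambda>n. measure (Q n) A) \<longlongrightarrow> l' A) F"
      and lR': "\<And>A. open A \<Longrightarrow> measure R' A \<le> l' A"
      using lims(2) unfolding limit_measure_def by blast
    \<comment> \<open>Limits of reals are unique, so the witnesses of both instances of the
      definition agree.\<close>
    have l'_eq: "l' = l"
      using tendsto_unique[OF F l' l] by blast
    interpret R: prob_space R using lims(1) by (simp add: limit_measure_def)
    interpret R': prob_space R' using lims(2) by (simp add: limit_measure_def)
    have sR: "sets R = sets borel" and sR': "sets R' = sets borel"
      using lims by (simp_all add: limit_measure_def)
    have sp: "space R' = UNIV"
      using sets_eq_imp_space_eq[OF sR'] by auto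
    define d where "d x = infdist x (- G)" for x
    have cont_d: "continuous_on UNIV d"
      unfolding d_def by (intro continuous_intros)
    have d: "x \<in> G \<longleftrightarrow> 0 < d x" for x
      using in_closed_iff_infdist_zero[of "- G" x] infdist_nonneg[of x "- G"] \<open>open G\<close> False
      by (auto simp: d_def closed_Compl less_le)
    define H where "H n = {x. inverse (real (Suc n)) < d x}" for n
    have opH: "open (H n)" for n
      unfolding H_def by (intro open_Collect_less cont_d continuous_on_const)
    have "measure R (H n) \<le> measure R' G" for n
    proof -
      \<comment> \<open>\<open>E\<close> is an open neighbourhood of the complement of
        \<open>G\<close> that misses \<open>H n\<close>, so its own complement lies in
        \<open>G\<close>.\<close>
      define E where "E = {x. d x < inverse (real (Suc n))}"
      have opE: "open E"
        unfolding E_def by (intro open_Collect_less cont_d continuous_on_const)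
      have "measure R (H n) \<le> l (H n)"
        by (rule lR[OF opH])
      also have "\<dots> \<le> 1 - l E"
      proof (rule tendsto_le[OF F])
        show "((\<lambda>m. 1 - measure (Q m) E) \<longlongrightarrow> 1 - l E) F"
          by (intro tendsto_intros l)
        show "\<forall>\<^sub>F m in F. measure (Q m) (H n) \<le> 1 - measure (Q m) E"
        proof (intro always_eventually allI)
          fix m
          interpret Qm: prob_space "Q m" by (rule Q)
          have "measure (Q m) (H n \<union> E) = measure (Q m) (H n) + measure (Q m) E"
            using opH opE Q(2) by (intro Qm.finite_measure_Union) (auto simp: H_def E_def)
          then show "measure (Q m) (H n) \<le> 1 - measure (Q m) E"
            using Qm.prob_le_1[of "H n \<union> E"] by simp
        qed
      qed (rule l)
      also have "\<dots> \<le> 1 - measure R' E"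
        using lR'[OF opE] l'_eq by simp
      also have "\<dots> = measure R' (UNIV - E)"
        using R'.prob_compl[of E] opE sR' by (simp add: sp)
      also have "\<dots> \<le> measure R' G"
      proof (intro R'.finite_measure_mono subsetI)
        fix x assume "x \<in> UNIV - E"
        then have "inverse (real (Suc n)) \<le> d x"
          by (simp add: E_def not_less)
        then show "x \<in> G"
          using less_le_trans[of 0 "inverse (real (Suc n))" "d x"] by (simp add: d)
      qed (use sR' \<open>open G\<close> in auto)
      finally show ?thesis .
    qed
    moreover have "(\<lambda>n. measure R (H n)) \<longlonglongrightarrow> measure R (\<Union>n. H n)"
    proof (intro R.finite_Lim_measure_incseq incseq_SucI)
      show "H n \<le> H (Suc n)" for n
      proof
        fix x assume "x \<in> H n"
        moreover have "inverse (real (Suc (Suc n))) \<le> inverse (real (Suc n))" by simp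
        ultimately show "x \<in> H (Suc n)"
          unfolding H_def mem_Collect_eq by linarith
      qed
    qed (use opH sR in auto)
    moreover have "(\<Union>n. H n) = G"
    proof (intro antisym subsetI)
      fix x assume "x \<in> G"
      then show "x \<in> (\<Union>n. H n)"
        using reals_Archimedean[of "d x"] by (auto simp: H_def d)
    next
      fix x assume "x \<in> (\<Union>n. H n)"
      then show "x \<in> G"
        using inverse_positive_iff_positive unfolding H_def d by (auto intro: less_trans[rotated])
    qed
    ultimately show ?thesis
      using LIMSEQ_le_const2[of "\<lambda>n. measure R (H n)"] by metis
  qed
  show ?thesis
    using R R' dom[OF R R'] by (intro prob_measure_eqI_open_le) (auto simp: limit_measure_def)
qed

lemma limit_measure_cong:
  assumes "limit_measure F Q R" "\<forall>\<^sub>F n in F. Q n = Q' n"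
  shows "limit_measure F Q' R"
proof -
  have "((\<lambda>n. measure (Q' n) A) \<longlongrightarrow> l) F" if "((\<lambda>n. measure (Q n) A) \<longlongrightarrow> l) F" for A l
    using that by (rule Lim_transform_eventually) (use assms(2) in eventually_elim, simp)
  then show ?thesis
    using assms(1) unfolding limit_measure_def by meson
qed

lemma limit_measure_const:
  "F \<noteq> bot \<Longrightarrow> prob_space R \<Longrightarrow> sets R = sets borel \<Longrightarrow> limit_measure F (\<lambda>_. R) R"
  unfolding limit_measure_def by (auto intro!: exI[of _ "measure R"])

lemma limit_measure_distr:
  fixes R :: "'b::topological_space measure" and f :: "'b \<Rightarrow> 'c::topological_space"
  assumes lim: "limit_measure F Q R" and Q: "\<And>n. sets (Q n) = sets borel"
    and f: "continuous_on UNIV f"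
  shows "limit_measure F (\<lambda>n. distr (Q n) borel f) (distr R borel f)"
proof -
  obtain l where l: "\<And>A. ((\<lambda>n. measure (Q n) A) \<longlongrightarrow> l A) F"
    and lR: "\<And>A. open A \<Longrightarrow> measure R A \<le> l A" and R: "F \<noteq> bot" "prob_space R" "sets R = sets borel"
    using lim unfolding limit_measure_def by blast
  have fm: "f \<in> measurable M borel" if "sets M = sets borel" for M
    using borel_measurable_continuous_onI[OF f] measurable_cong_sets[OF that refl] by blast
  have sp: "space M = UNIV" if "sets M = sets (borel :: 'b measure)" for M
    using sets_eq_imp_space_eq[OF that] by simp
  \<comment> \<open>The definition of \<open>limit_measure\<close> asks for limits on all sets; a
    nonmeasurable set has measure 0 under every \<open>distr\<close>, so 0 is its limit.\<close>
  define l' where "l' A = (if A \<in> sets borel then l (f -` A) else 0)" for A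
  have "((\<lambda>n. measure (distr (Q n) borel f) A) \<longlongrightarrow> l' A) F" for A
  proof (cases "A \<in> sets borel")
    case True
    then show ?thesis
      using l[of "f -` A"] by (simp add: l'_def measure_distr[OF fm[OF Q]] sp[OF Q])
  next
    case False
    then show ?thesis
      by (simp add: l'_def measure_notin_sets)
  qed
  moreover have "measure (distr R borel f) A \<le> l' A" if "open A" for A
    using lR[of "f -` A"] that f
    by (simp add: l'_def measure_distr[OF fm[OF R(3)]] sp[OF R(3)] open_vimage)
  ultimately show ?thesis
    using R prob_space.prob_space_distr[OF R(2) fm[OF R(3)]] unfolding limit_measure_def by auto
qed

section \<open>Integrals of lower semi-continuous functions in the limit\<close>

text \<open>The sum counts the integers from 1 to \<open>L\<close> strictly below \<open>y\<close>.
  With \<open>y\<close> a scaled function value it is the staircase of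
  \<open>limit_measure_nn_integral_le\<close>; strictness matters there because the sets where
  \<open>a < f x\<close> are the open ones.\<close>

lemma sum_of_bool_less_bounds:
  fixes y :: real
  assumes "0 \<le> y"
  shows "(real L < y \<longrightarrow> (\<Sum>k<L. of_bool (real (Suc k) < y) :: real) = real L) \<and>
    (y \<le> real L \<longrightarrow> y - 1 \<le> (\<Sum>k<L. of_bool (real (Suc k) < y) :: real) \<and> (\<Sum>k<L. of_bool (real (Suc k) < y) :: real) \<le> y)"
proof (induction L)
  case (Suc L)
  show ?case
  proof (cases "real L < y")
    case True
    with Suc have "(\<Sum>k<L. of_bool (real (Suc k) < y) :: real) = real L" by simp
    then show ?thesis
      using True by (simp del: sum_of_bool_eq)
  next
    case False
    with Suc show ?thesis
      by (simp del: sum_of_bool_eq)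
  qed
qed (use assms in simp)

lemma lsc_borel_measurable: "lsc f \<Longrightarrow> f \<in> borel_measurable borel"
  by (auto simp: lsc_def borel_measurable_iff_greater)

text \<open>A layer-cake argument. Each staircase \<open>s n\<close> is a combination of indicators
  of open sets, on which the mass under \<open>R\<close> is below the limit of the masses; Fatou's
  lemma for \<open>R\<close> then lets the staircases tend to \<open>f\<close>.\<close>

lemma limit_measure_nn_integral_le:
  fixes f :: "'b::topological_space \<Rightarrow> real"
  assumes lim: "limit_measure F Q R" and Q: "\<And>n. prob_space (Q n)" "\<And>n. sets (Q n) = sets borel"
    and f: "lsc f" "\<And>x. 0 \<le> f x"
    and le: "\<forall>\<^sub>F n in F. (\<integral>\<^sup>+ x. ennreal (f x) \<partial>Q n) \<le> ennreal (b n)" and b: "(b \<longlongrightarrow> \<beta>) F"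
  shows "(\<integral>\<^sup>+ x. ennreal (f x) \<partial>R) \<le> ennreal \<beta>"
proof -
  obtain l where l: "\<And>A. ((\<lambda>n. measure (Q n) A) \<longlongrightarrow> l A) F"
    and lR: "\<And>A. open A \<Longrightarrow> measure R A \<le> l A" and F: "F \<noteq> bot" and R: "prob_space R" "sets R = sets borel"
    using lim unfolding limit_measure_def by blast
  \<comment> \<open>There are \<open>Suc n * Suc n\<close> levels of height
    \<open>1 / Suc n\<close>, so the staircase reaches height \<open>Suc n\<close> and, below that
    height, misses \<open>f\<close> by at most one level.\<close>
  define s where "s n x = (1 / real (Suc n)) * (\<Sum>k<Suc n * Suc n. indicator {x. real (Suc k) / real (Suc n) < f x} x)" for n x
  have op: "open {x. a < f x}" for a
    using f(1) by (simp add: lsc_def)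
  define T where "T n x = (\<Sum>k<Suc n * Suc n. of_bool (real (Suc k) < real (Suc n) * f x) :: real)" for n x
  have s_alt: "s n x = T n x / real (Suc n)" for n x
  proof -
    have "indicator {x. real (Suc k) / real (Suc n) < f x} x = (of_bool (real (Suc k) < real (Suc n) * f x) :: real)" for k
      by (simp add: indicator_def divide_less_eq mult.commute del: of_nat_Suc)
    then show ?thesis
      unfolding s_def T_def by simp
  qed
  have T: "real (Suc n * Suc n) < real (Suc n) * f x \<longrightarrow> T n x = real (Suc n * Suc n)"
    "real (Suc n) * f x \<le> real (Suc n * Suc n) \<longrightarrow> real (Suc n) * f x - 1 \<le> T n x \<and> T n x \<le> real (Suc n) * f x" for n x
    using sum_of_bool_less_bounds[of "real (Suc n) * f x" "Suc n * Suc n"] f(2)[of x] unfolding T_def by auto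
  have s_le: "s n x \<le> f x" for n x
  proof -
    have "T n x \<le> real (Suc n) * f x"
      using T[of n x] by linarith
    then show ?thesis
      unfolding s_alt by (simp add: divide_le_eq mult.commute del: of_nat_Suc)
  qed
  have s_ge: "f x - 1 / real (Suc n) \<le> s n x" if "f x \<le> real (Suc n)" for n x
  proof -
    have "real (Suc n) * f x \<le> real (Suc n * Suc n)"
      using that by (simp only: of_nat_mult) (intro mult_left_mono, auto)
    then have "(real (Suc n) * f x - 1) / real (Suc n) \<le> s n x"
      using T(2)[of n x] unfolding s_alt by (intro divide_right_mono) auto
    then show ?thesis
      by (simp add: diff_divide_distrib del: of_nat_Suc)
  qed
  have s_nonneg: "0 \<le> s n x" for n x
    by (simp add: s_def sum_nonneg)
  have s_lim: "(\<lambda>n. s n x) \<longlonglongrightarrow> f x" for x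
  proof (rule tendsto_sandwich)
    show "\<forall>\<^sub>F n in sequentially. f x - 1 / real (Suc n) \<le> s n x"
      using eventually_ge_at_top[of "nat \<lceil>f x\<rceil>"] by eventually_elim (intro s_ge, linarith)
    show "(\<lambda>n. f x - 1 / real (Suc n)) \<longlonglongrightarrow> f x"
      using tendsto_diff[OF tendsto_const LIMSEQ_inverse_real_of_nat, of "f x"]
      by (simp add: inverse_eq_divide)
  qed (use s_le in auto)
  have int_s: "(\<integral>\<^sup>+ x. ennreal (s n x) \<partial>M) =
      ennreal ((1 / real (Suc n)) * (\<Sum>k<Suc n * Suc n. measure M {x. real (Suc k) / real (Suc n) < f x}))"
    if M: "prob_space M" "sets M = sets borel" for M n
  proof -
    interpret prob_space M by fact
    have [measurable]: "{x. a < f x} \<in> sets M" for a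
      using op M(2) by auto
    have "(\<integral>\<^sup>+ x. ennreal (h * (\<Sum>k<L. indicator {x. t k < f x} x)) \<partial>M) =
        ennreal (h * (\<Sum>k<L. measure M {x. t k < f x}))" if "0 \<le> h" for h and L :: nat and t
    proof -
      have "(\<integral>\<^sup>+ x. ennreal (h * (\<Sum>k<L. indicator {x. t k < f x} x)) \<partial>M) =
          (\<integral>\<^sup>+ x. ennreal h * (\<Sum>k<L. indicator {x. t k < f x} x) \<partial>M)"
        using that by (intro nn_integral_cong) (simp add: ennreal_mult sum_nonneg ennreal_indicator flip: sum_ennreal)
      also have "\<dots> = ennreal h * (\<Sum>k<L. emeasure M {x. t k < f x})"
        by (simp add: nn_integral_cmult nn_integral_sum)
      finally show ?thesis
        using that by (simp add: emeasure_eq_measure ennreal_mult sum_nonneg flip: sum_ennreal)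
    qed
    note * = this
    show ?thesis
      unfolding s_def by (rule *) simp
  qed
  have "(\<integral>\<^sup>+ x. ennreal (s n x) \<partial>R) \<le> ennreal \<beta>" for n
  proof -
    have "(1 / real (Suc n)) * (\<Sum>k<Suc n * Suc n. measure R {x. real (Suc k) / real (Suc n) < f x})
      \<le> (1 / real (Suc n)) * (\<Sum>k<Suc n * Suc n. l {x. real (Suc k) / real (Suc n) < f x})"
      by (intro mult_left_mono sum_mono lR op) auto
    \<comment> \<open>\<open>ennreal\<close> truncates negative bounds to 0, hence the comparison
      with \<open>max 0\<close>.\<close>
    also have "\<dots> \<le> max 0 \<beta>"
    proof (rule tendsto_le[OF F])
      show "((\<lambda>n. max 0 (b n)) \<longlongrightarrow> max 0 \<beta>) F"
        by (intro tendsto_intros b)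
      show "((\<lambda>m. (1 / real (Suc n)) * (\<Sum>k<Suc n * Suc n. measure (Q m) {x. real (Suc k) / real (Suc n) < f x}))
        \<longlongrightarrow> (1 / real (Suc n)) * (\<Sum>k<Suc n * Suc n. l {x. real (Suc k) / real (Suc n) < f x})) F"
        by (intro tendsto_intros l)
      show "\<forall>\<^sub>F m in F. (1 / real (Suc n)) * (\<Sum>k<Suc n * Suc n. measure (Q m) {x. real (Suc k) / real (Suc n) < f x})
        \<le> max 0 (b m)"
        using le
      proof eventually_elim
        fix m assume "(\<integral>\<^sup>+ x. ennreal (f x) \<partial>Q m) \<le> ennreal (b m)"
        moreover have "(\<integral>\<^sup>+ x. ennreal (s n x) \<partial>Q m) \<le> (\<integral>\<^sup>+ x. ennreal (f x) \<partial>Q m)"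
          by (intro nn_integral_mono ennreal_leI s_le)
        ultimately have "(\<integral>\<^sup>+ x. ennreal (s n x) \<partial>Q m) \<le> ennreal (max 0 (b m))"
          by (simp add: ennreal_max_0)
        then show "(1 / real (Suc n)) * (\<Sum>k<Suc n * Suc n. measure (Q m) {x. real (Suc k) / real (Suc n) < f x})
            \<le> max 0 (b m)"
          unfolding int_s[OF Q] by (subst (asm) ennreal_le_iff) auto
      qed
    qed
    finally show ?thesis
      unfolding int_s[OF R] by (metis ennreal_leI ennreal_max_0)
  qed
  then have "liminf (\<lambda>n. \<integral>\<^sup>+ x. ennreal (s n x) \<partial>R) \<le> ennreal \<beta>"
    by (intro Liminf_le always_eventually) auto
  moreover have "(\<integral>\<^sup>+ x. liminf (\<lambda>n. ennreal (s n x)) \<partial>R) \<le> liminf (\<lambda>n. \<integral>\<^sup>+ x. ennreal (s n x) \<partial>R)"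
  proof (rule nn_integral_liminf)
    have [measurable]: "{x. a < f x} \<in> sets R" for a
      using op R(2) by auto
    show "(\<lambda>x. ennreal (s n x)) \<in> borel_measurable R" for n
      unfolding s_def by measurable
  qed
  moreover have "liminf (\<lambda>n. ennreal (s n x)) = ennreal (f x)" for x
    by (intro lim_imp_Liminf tendsto_ennrealI s_lim) simp
  ultimately show ?thesis by simp
qed

section \<open>Expectations, mixtures and lower semi-continuous functions\<close>

lemma expect_integrable: "integrable P f \<Longrightarrow> expect P f = ereal (\<integral>x. f x \<partial>P)"
  unfolding real_integrable_def expect_def real_lebesgue_integral_def
  by (cases rule: ennreal2_cases[of "\<integral>\<^sup>+ x. ennreal (f x) \<partial>P" "\<integral>\<^sup>+ x. ennreal (- f x) \<partial>P"])
     (auto simp: real_lebesgue_integral_def real_integrable_def)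

text \<open>An infinite integral of the negative part, next to a finite one of the positive part,
  would make the expectation minus infinity, which is not above \<open>a\<close>.\<close>

lemma expect_gt_imp_integrable:
  assumes f: "f \<in> borel_measurable P" and fin: "(\<integral>\<^sup>+ x. ennreal (f x) \<partial>P) < \<infinity>"
    and gt: "ereal a < expect P f"
  shows "integrable P f" "a < (\<integral>x. f x \<partial>P)"
proof -
  have "(\<integral>\<^sup>+ x. ennreal (- f x) \<partial>P) \<noteq> \<infinity>"
  proof
    assume inf: "(\<integral>\<^sup>+ x. ennreal (- f x) \<partial>P) = \<infinity>"
    obtain r where "(\<integral>\<^sup>+ x. ennreal (f x) \<partial>P) = ennreal r" "0 \<le> r"
      using fin by (auto simp: less_top_ennreal)
    with inf gt show False
      by (simp add: expect_def)
  qed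
  then show int: "integrable P f"
    using f fin by (simp add: real_integrable_def)
  show "a < (\<integral>x. f x \<partial>P)"
    using gt expect_integrable[OF int] by simp
qed

lemma ennreal_sum_le: "ennreal (\<Sum>a\<in>A. f a) \<le> (\<Sum>a\<in>A. ennreal (f a))"
proof -
  have "ennreal (\<Sum>a\<in>A. f a) \<le> ennreal (\<Sum>a\<in>A. max 0 (f a))"
    by (intro ennreal_leI sum_mono) auto
  also have "\<dots> = (\<Sum>a\<in>A. ennreal (max 0 (f a)))"
    by (subst sum_ennreal) auto
  finally show ?thesis
    by (simp only: ennreal_max_0)
qed

text \<open>Finite positive parts of all terms leave no room for cancellation in the average, so its
  integrability is inherited by each term. This splits the symmetrized loss into its permuted
  terms.\<close>

lemma expect_average_gt:
  fixes f :: "'i \<Rightarrow> 'b \<Rightarrow> real"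
  assumes A: "finite A" and f: "\<And>a. a \<in> A \<Longrightarrow> f a \<in> borel_measurable P"
    and fin: "\<And>a. a \<in> A \<Longrightarrow> (\<integral>\<^sup>+ x. ennreal (f a x) \<partial>P) < \<infinity>"
    and d: "0 < d" and gt: "ereal \<alpha> < expect P (\<lambda>x. (\<Sum>a\<in>A. f a x) / d)"
  shows "\<And>a. a \<in> A \<Longrightarrow> integrable P (f a)" "\<alpha> < (\<Sum>a\<in>A. \<integral>x. f a x \<partial>P) / d"
proof -
  define h where "h x = (\<Sum>a\<in>A. f a x) / d" for x
  have hm: "h \<in> borel_measurable P"
    unfolding h_def using f by (intro borel_measurable_divide borel_measurable_sum) auto
  have "(\<integral>\<^sup>+ x. ennreal (h x) \<partial>P) \<le> (\<integral>\<^sup>+ x. ennreal (1 / d) * (\<Sum>a\<in>A. ennreal (f a x)) \<partial>P)"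
  proof (rule nn_integral_mono)
    fix x
    have "ennreal (h x) = ennreal (1 / d) * ennreal (\<Sum>a\<in>A. f a x)"
      using d by (simp add: h_def flip: ennreal_mult')
    then show "ennreal (h x) \<le> ennreal (1 / d) * (\<Sum>a\<in>A. ennreal (f a x))"
      by (simp add: mult_left_mono ennreal_sum_le)
  qed
  also have "\<dots> = ennreal (1 / d) * (\<Sum>a\<in>A. \<integral>\<^sup>+ x. ennreal (f a x) \<partial>P)"
    using f by (subst nn_integral_cmult) (auto simp: nn_integral_sum)
  also have "\<dots> < \<infinity>"
    using fin A by (auto simp: ennreal_mult_less_top)
  finally have hint: "integrable P h" and h\<alpha>: "\<alpha> < (\<integral>x. h x \<partial>P)"
    using expect_gt_imp_integrable[OF hm _ gt[folded h_def]] by auto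
  show int: "integrable P (f a)" if a: "a \<in> A" for a
  proof (rule Bochner_Integration.integrable_bound)
    have "integrable P (\<lambda>x. max 0 (f b x))" if "b \<in> A" for b
      unfolding real_integrable_def using f[OF that] fin[OF that] by (simp add: ennreal_max_0 ennreal_neg)
    then show "integrable P (\<lambda>x. 2 * (\<Sum>b\<in>A. max 0 (f b x)) + d * \<bar>h x\<bar>)"
      using hint by auto
    show "AE x in P. norm (f a x) \<le> norm (2 * (\<Sum>b\<in>A. max 0 (f b x)) + d * \<bar>h x\<bar>)"
    proof (intro AE_I2)
      fix x
      \<comment> \<open>\<open>f a x \<le> S\<close>, and \<open>- f a x\<close> is the sum of the
        other terms minus \<open>d * h x\<close>; both are dominated.\<close>
      define S where "S = (\<Sum>b\<in>A. max 0 (f b x))"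
      have "0 \<le> S" unfolding S_def by (intro sum_nonneg) auto
      have "f a x \<le> S"
        unfolding S_def using A a member_le_sum[of a A "\<lambda>b. max 0 (f b x)"] by auto
      have "d * h x = f a x + (\<Sum>b\<in>A - {a}. f b x)"
        using d A a by (simp add: h_def sum.remove)
      moreover have "(\<Sum>b\<in>A - {a}. f b x) \<le> (\<Sum>b\<in>A - {a}. max 0 (f b x))"
        by (intro sum_mono) auto
      moreover have "(\<Sum>b\<in>A - {a}. max 0 (f b x)) \<le> S"
        unfolding S_def using A by (intro sum_mono2) auto
      moreover have "- (d * h x) \<le> d * \<bar>h x\<bar>" "0 \<le> d * \<bar>h x\<bar>"
        using d by (auto simp: abs_if)
      ultimately have "\<bar>f a x\<bar> \<le> 2 * S + d * \<bar>h x\<bar>"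
        using \<open>0 \<le> S\<close> \<open>f a x \<le> S\<close> by linarith
      then show "norm (f a x) \<le> norm (2 * (\<Sum>b\<in>A. max 0 (f b x)) + d * \<bar>h x\<bar>)"
        unfolding S_def by simp
    qed
  qed (use f a in auto)
  have "(\<integral>x. h x \<partial>P) = (\<Sum>a\<in>A. \<integral>x. f a x \<partial>P) / d"
    unfolding h_def using int by (simp add: Bochner_Integration.integral_sum)
  with h\<alpha> show "\<alpha> < (\<Sum>a\<in>A. \<integral>x. f a x \<partial>P) / d" by simp
qed

text \<open>The mixture is the law of \<open>T a x\<close> for independent \<open>a\<close>, uniform
  on \<open>A\<close>, and \<open>x\<close> distributed according to \<open>M\<close>.\<close>

lemma finite_mixture:
  fixes T :: "'i \<Rightarrow> 'b \<Rightarrow> 'c"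
  assumes M: "prob_space M" and A: "finite A" "A \<noteq> {}" and T: "\<And>a. a \<in> A \<Longrightarrow> T a \<in> measurable M N"
  obtains R where "prob_space R" "sets R = sets N"
    "\<And>f. f \<in> borel_measurable N \<Longrightarrow>
      (\<integral>\<^sup>+ z. f z \<partial>R) = (\<Sum>a\<in>A. \<integral>\<^sup>+ x. f (T a x) \<partial>M) / ennreal (real (card A))"
proof -
  let ?U = "uniform_count_measure A"
  interpret M: prob_space M by fact
  interpret U: prob_space ?U
    using A by (rule prob_space_uniform_count_measure)
  interpret UM: pair_prob_space ?U M ..
  have "case_prod T \<in> measurable (count_space A \<Otimes>\<^sub>M M) N"
    using A T by (intro measurable_pair_measure_countable1) (auto simp: countable_finite)
  then have Tm: "case_prod T \<in> measurable (?U \<Otimes>\<^sub>M M) N"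
    using measurable_cong_sets[OF sets_pair_measure_cong[OF sets_uniform_count_measure_count_space refl] refl] by blast
  show ?thesis
  proof
    show "prob_space (distr (?U \<Otimes>\<^sub>M M) N (case_prod T))"
      by (rule UM.prob_space_distr[OF Tm])
    show "sets (distr (?U \<Otimes>\<^sub>M M) N (case_prod T)) = sets N" by simp
    fix f :: "'c \<Rightarrow> ennreal" assume f[measurable]: "f \<in> borel_measurable N"
    have "(\<integral>\<^sup>+ z. f z \<partial>distr (?U \<Otimes>\<^sub>M M) N (case_prod T)) = (\<integral>\<^sup>+ w. f (case_prod T w) \<partial>(?U \<Otimes>\<^sub>M M))"
      using Tm f by (intro nn_integral_distr) auto
    also have "\<dots> = (\<integral>\<^sup>+ a. \<integral>\<^sup>+ x. f (T a x) \<partial>M \<partial>?U)"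
      using measurable_compose[OF Tm f] by (subst M.nn_integral_fst[symmetric]) auto
    also have "\<dots> = (\<Sum>a\<in>A. ennreal (1 / real (card A)) * (\<integral>\<^sup>+ x. f (T a x) \<partial>M))"
      using A unfolding uniform_count_measure_def by (subst nn_integral_point_measure_finite) auto
    also have "\<dots> = (\<Sum>a\<in>A. \<integral>\<^sup>+ x. f (T a x) \<partial>M) / ennreal (real (card A))"
      using A by (simp add: divide_ennreal_def inverse_ennreal card_gt_0_iff inverse_eq_divide mult.commute
          flip: sum_distrib_left)
    finally show "(\<integral>\<^sup>+ z. f z \<partial>distr (?U \<Otimes>\<^sub>M M) N (case_prod T)) =
        (\<Sum>a\<in>A. \<integral>\<^sup>+ x. f (T a x) \<partial>M) / ennreal (real (card A))" .
  qed
qed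

text \<open>Positive and negative parts are averaged separately, as nonnegative integrands.\<close>

lemma mixture_integral:
  fixes f :: "'c \<Rightarrow> real"
  assumes A: "finite A" "A \<noteq> {}"
    and R: "sets R = sets N" "\<And>g. g \<in> borel_measurable N \<Longrightarrow>
      (\<integral>\<^sup>+ z. g z \<partial>R) = (\<Sum>a\<in>A. \<integral>\<^sup>+ x. g (T a x) \<partial>M) / ennreal (real (card A))"
    and f: "f \<in> borel_measurable N" and int: "\<And>a. a \<in> A \<Longrightarrow> integrable M (\<lambda>x. f (T a x))"
  shows "integrable R f" "(\<integral>z. f z \<partial>R) = (\<Sum>a\<in>A. \<integral>x. f (T a x) \<partial>M) / real (card A)"
proof -
  define p where "p a = enn2real (\<integral>\<^sup>+ x. ennreal (f (T a x)) \<partial>M)" for a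
  define m where "m a = enn2real (\<integral>\<^sup>+ x. ennreal (- f (T a x)) \<partial>M)" for a
  have pm: "(\<integral>\<^sup>+ x. ennreal (f (T a x)) \<partial>M) = ennreal (p a)"
    "(\<integral>\<^sup>+ x. ennreal (- f (T a x)) \<partial>M) = ennreal (m a)" if "a \<in> A" for a
    using int[OF that] unfolding real_integrable_def p_def m_def by (auto simp: ennreal_enn2real less_top)
  have nn: "0 \<le> p a" "0 \<le> m a" for a
    by (auto simp: p_def m_def)
  have card: "0 < real (card A)"
    using A by (simp add: card_gt_0_iff)
  have ip: "(\<integral>\<^sup>+ z. ennreal (f z) \<partial>R) = ennreal ((\<Sum>a\<in>A. p a) / real (card A))"
    using f nn card by (subst R(2)) (auto simp: pm divide_ennreal sum_nonneg)
  have im: "(\<integral>\<^sup>+ z. ennreal (- f z) \<partial>R) = ennreal ((\<Sum>a\<in>A. m a) / real (card A))"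
    using f nn card by (subst R(2)) (auto simp: pm divide_ennreal sum_nonneg)
  show iR: "integrable R f"
    unfolding real_integrable_def ip im using f measurable_cong_sets[OF R(1) refl] by auto
  have "(\<integral>x. f (T a x) \<partial>M) = p a - m a" if "a \<in> A" for a
    using int[OF that] by (simp add: real_lebesgue_integral_def p_def m_def)
  then show "(\<integral>z. f z \<partial>R) = (\<Sum>a\<in>A. \<integral>x. f (T a x) \<partial>M) / real (card A)"
    unfolding real_lebesgue_integral_def[OF iR] ip im using nn
    by (simp add: sum_nonneg sum_subtractf diff_divide_distrib)
qed

section \<open>Semi-continuity and transportation costs\<close>

lemma lsc_const: "lsc (\<lambda>_. k)"
  by (simp add: lsc_def)

lemma lsc_add:
  assumes "lsc f" "lsc g" shows "lsc (\<lambda>x. f x + g x)"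
proof -
  have "{x. a < f x + g x} = (\<Union>r. {x. r < f x} \<inter> {x. a - r < g x})" for a
  proof (intro set_eqI iffI)
    fix x assume "x \<in> {x. a < f x + g x}"
    then obtain r where "a - g x < r" "r < f x"
      using dense[of "a - g x" "f x"] by auto
    then show "x \<in> (\<Union>r. {x. r < f x} \<inter> {x. a - r < g x})"
      by (auto intro!: exI[of _ r])
  qed auto
  then show ?thesis
    using assms unfolding lsc_def by (auto intro!: open_UN open_Int)
qed

lemma lsc_cmult:
  assumes "lsc f" "0 \<le> k" shows "lsc (\<lambda>x. k * f x)"
proof (cases "k = 0")
  case False
  then have "{x. a < k * f x} = {x. a / k < f x}" for a
    using assms(2) by (auto simp: field_simps)
  then show ?thesis
    using assms(1) by (simp add: lsc_def)
qed (simp add: lsc_const)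

lemma lsc_sum: "(\<And>i. i \<in> I \<Longrightarrow> lsc (f i)) \<Longrightarrow> lsc (\<lambda>x. \<Sum>i\<in>I. f i x)"
  by (induction I rule: infinite_finite_induct) (auto intro: lsc_add lsc_const)

lemma lsc_compose:
  assumes "lsc f" "continuous_on UNIV g" shows "lsc (\<lambda>x. f (g x))"
  unfolding lsc_def
proof
  fix a
  show "open {x. a < f (g x)}"
    using open_vimage[OF _ assms(2), of "{y. a < f y}"] assms(1) by (simp add: lsc_def vimage_def)
qed

text \<open>Semi-continuity of the loss refers to a product topology on extensional functions;
  composing with a continuous \<open>g\<close> moves it to the topology of a type, where
  \<open>lsc\<close> lives.\<close>

lemma usc_on_compose:
  assumes "usc_on T f" "continuous_map euclidean T g" shows "lsc (\<lambda>x. - f (g x))"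
  unfolding lsc_def
proof
  fix a
  have "openin euclidean {x \<in> topspace euclidean. g x \<in> {y \<in> topspace T. f y < - a}}"
    using assms unfolding usc_on_def by (intro openin_continuous_map_preimage[OF assms(2)]) auto
  moreover have "{x \<in> topspace euclidean. g x \<in> {y \<in> topspace T. f y < - a}} = {x. a < - f (g x)}"
    using continuous_map_image_subset_topspace[OF assms(2)] by auto
  ultimately show "open {x. a < - f (g x)}" by simp
qed

text \<open>The axioms force this:
  \<open>0 = c x x \<le> C * (c x y + c y x) = 2 * C * c x y\<close>.\<close>

lemma proper_cost_nonneg:
  assumes "proper_cost c" shows "0 \<le> c x y"
proof -
  obtain C where C: "C \<ge> 1" "\<And>x y z. c x z \<le> C * (c x y + c y z)"
    using assms by (auto simp: proper_cost_def)
  have "c x x = 0" "c y x = c x y"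
    using assms by (auto simp: proper_cost_def)
  with C(2)[of x x y] C(1) show ?thesis
    by (simp add: zero_le_mult_iff)
qed

lemma proper_cost_lsc:
  fixes c :: "'a::topological_space \<Rightarrow> 'a \<Rightarrow> real"
  assumes "proper_cost c" "continuous_on UNIV f" "continuous_on UNIV g"
  shows "lsc (\<lambda>z. c (f z) (g z))"
  using lsc_compose[of "\<lambda>z. c (fst z) (snd z)" "\<lambda>z. (f z, g z)"] assms
  by (auto simp: proper_cost_def intro!: continuous_on_Pair)

lemma proper_cost_measurable:
  fixes c :: "'a::second_countable_topology \<Rightarrow> 'a \<Rightarrow> real"
  assumes c: "proper_cost c" and f: "f \<in> borel_measurable M" and g: "g \<in> borel_measurable M"
  shows "(\<lambda>z. c (f z) (g z)) \<in> borel_measurable M"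
proof -
  have "(\<lambda>z. c (fst z) (snd z)) \<in> borel_measurable borel"
    using c by (intro lsc_borel_measurable) (simp add: proper_cost_def)
  from measurable_compose[OF borel_measurable_Pair[OF f g] this] show ?thesis by simp
qed

text \<open>Beyond some radius sublinearity gives \<open>\<delta> r < \<epsilon> * r\<close>; below
  it \<open>\<delta> r \<le> r\<close> bounds the gauge by that radius.\<close>

lemma gauge_linear_bound:
  assumes "gaugeD \<delta>" "0 < \<epsilon>"
  shows "\<exists>D\<ge>0. \<forall>r\<ge>0. \<delta> r \<le> D + \<epsilon> * r"
proof -
  have "\<forall>\<^sub>F r in at_top. \<delta> r / r < \<epsilon>"
    using assms order_tendstoD(2)[of "\<lambda>r. \<delta> r / r" 0 at_top \<epsilon>] by (simp add: gaugeD_def)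
  then obtain r0 where r0: "\<And>r. r0 \<le> r \<Longrightarrow> \<delta> r / r < \<epsilon>"
    by (auto simp: eventually_at_top_linorder)
  \<comment> \<open>The maximum with 1 keeps \<open>r\<close> positive where the quotient by
    \<open>r\<close> is used.\<close>
  have "\<delta> r \<le> max r0 1 + \<epsilon> * r" if "0 \<le> r" for r
  proof (cases "max r0 1 \<le> r")
    case True
    then have "\<delta> r < \<epsilon> * r"
      using r0[of r] by (simp add: divide_less_eq)
    then show ?thesis by simp
  next
    case False
    then have "\<delta> r \<le> max r0 1"
      using assms(1) that unfolding gaugeD_def by force
    then show ?thesis
      using assms(2) that by (simp add: add_increasing2)
  qed
  then show ?thesis
    by (intro exI[of _ "max r0 1"]) auto
qed

section \<open>Tightness from moment bounds\<close>

text \<open>Tychonoff for sublevel sets. The radius depends on the coordinate because infinitely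
  many coordinates must share a finite total of escaping mass.\<close>

lemma compact_cost_box:
  fixes c :: "'a::topological_space \<Rightarrow> 'a \<Rightarrow> real"
  assumes "proper_cost c"
  shows "compact {z :: nat \<Rightarrow> 'a \<times> 'a. \<forall>i. c x0 (fst (z i)) \<le> r i \<and> c x0 (snd (z i)) \<le> r i}"
proof -
  let ?B = "\<lambda>i. {x. c x0 x \<le> r i} \<times> {x. c x0 x \<le> r i}"
  have "compact {x. c x0 x \<le> t}" for t
    using assms unfolding proper_cost_def by blast
  then have "compact (?B i)" for i
    by (intro compact_Times)
  then have "compact (PiE UNIV ?B)"
    using compactin_PiE[of "\<lambda>_. euclidean" UNIV ?B] by (simp add: euclidean_product_topology)
  moreover have "PiE UNIV ?B = {z. \<forall>i. c x0 (fst (z i)) \<le> r i \<and> c x0 (snd (z i)) \<le> r i}"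
    by (auto simp: PiE_iff mem_Times_iff)
  ultimately show ?thesis by simp
qed

text \<open>Markov's inequality in each coordinate of each block and a union bound confine all but
  mass \<open>e\<close> to one box of \<open>compact_cost_box\<close>.\<close>

lemma moment_bound_imp_tight:
  fixes c :: "'a::polish_space \<Rightarrow> 'a \<Rightarrow> real" and Q :: "nat \<Rightarrow> (nat \<Rightarrow> 'a \<times> 'a) measure"
  assumes c: "proper_cost c" and Q: "\<And>n. prob_space (Q n)" "\<And>n. sets (Q n) = sets borel"
    and B: "0 < B" "\<And>n i. (\<integral>\<^sup>+ z. ennreal (c x0 (fst (z i))) \<partial>Q n) \<le> ennreal B"
      "\<And>n i. (\<integral>\<^sup>+ z. ennreal (c x0 (snd (z i))) \<partial>Q n) \<le> ennreal B"
    and e: "0 < e"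
  shows "\<exists>K. compact K \<and> (\<forall>n. 1 - e \<le> measure (Q n) K)"
proof -
  \<comment> \<open>By Markov's inequality each block leaves this radius with probability at most
    \<open>e / 2^(i+2)\<close>; both blocks together give \<open>e / 2^(i+1)\<close>, which sums to
    \<open>e\<close>.\<close>
  define r where "r i = B * 2 ^ (i + 2) / e" for i :: nat
  have r: "0 < r i" "B / r i = e * (1/2) ^ (i + 2)" for i
    using B(1) e by (auto simp: r_def field_simps power_divide)
  define K where "K = {z :: nat \<Rightarrow> 'a \<times> 'a. \<forall>i. c x0 (fst (z i)) \<le> r i \<and> c x0 (snd (z i)) \<le> r i}"
  have K: "compact K"
    unfolding K_def using c by (rule compact_cost_box)
  have "1 - e \<le> measure (Q n) K" for n
  proof -
    interpret prob_space "Q n" by (rule Q)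
    have sp: "space (Q n) = UNIV"
      using sets_eq_imp_space_eq[OF Q(2)[of n]] by simp
    have proj_meas: "(\<lambda>z. z i) \<in> borel_measurable (Q n)" for i
      using borel_measurable_continuous_onI[OF continuous_on_product_coordinates, of i]
        measurable_cong_sets[OF Q(2) refl] by blast
    have meas: "(\<lambda>z. c x0 (fst (z i))) \<in> borel_measurable (Q n)" "(\<lambda>z. c x0 (snd (z i))) \<in> borel_measurable (Q n)" for i
      by (intro proper_cost_measurable[OF c] measurable_const measurable_compose[OF proj_meas]
            borel_measurable_continuous_onI continuous_intros)+ auto
    have Markov: "emeasure (Q n) {z. r i < u z} \<le> ennreal (e * (1/2) ^ (i + 2))"
      if u: "u \<in> borel_measurable (Q n)" and le: "(\<integral>\<^sup>+ z. ennreal (u z) \<partial>Q n) \<le> ennreal B" for u i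
    proof -
      have "emeasure (Q n) {z. r i < u z} \<le> emeasure (Q n) ({z \<in> UNIV. 1 \<le> ennreal (1 / r i) * ennreal (u z)} \<inter> UNIV)"
      proof (rule emeasure_mono)
        show "{z. r i < u z} \<subseteq> {z \<in> UNIV. 1 \<le> ennreal (1 / r i) * ennreal (u z)} \<inter> UNIV"
          using r(1)[of i] by (auto simp: le_divide_eq ennreal_1[symmetric] simp del: ennreal_1 simp flip: ennreal_mult')
        show "{z \<in> UNIV. 1 \<le> ennreal (1 / r i) * ennreal (u z)} \<inter> UNIV \<in> sets (Q n)"
          using borel_measurable_le[of "\<lambda>_. 1" "Q n" "\<lambda>z. ennreal (1 / r i) * ennreal (u z)"] u sp by auto
      qed
      also have "\<dots> \<le> ennreal (1 / r i) * (\<integral>\<^sup>+ z. ennreal (u z) * indicator UNIV z \<partial>Q n)"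
        using u sp sets.top[of "Q n"] nn_integral_Markov_inequality[of "\<lambda>z. ennreal (u z)" UNIV "Q n" "ennreal (1 / r i)"]
        by auto
      also have "\<dots> \<le> ennreal (1 / r i) * ennreal B"
        using le by (intro mult_left_mono) auto
      also have "\<dots> = ennreal (e * (1/2) ^ (i + 2))"
        using r(1)[of i] B(1) unfolding r(2)[symmetric] by (simp flip: ennreal_mult')
      finally show ?thesis .
    qed
    define E where "E i = {z. r i < c x0 (fst (z i))} \<union> {z. r i < c x0 (snd (z i))}" for i
    have Em: "E i \<in> sets (Q n)" for i
      using borel_measurable_less[of "\<lambda>_. r i" "Q n" "\<lambda>z. c x0 (fst (z i))"]
        borel_measurable_less[of "\<lambda>_. r i" "Q n" "\<lambda>z. c x0 (snd (z i))"] meas[of i] sp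
      unfolding E_def by (intro sets.Un) auto
    have "emeasure (Q n) (\<Union>i. E i) \<le> (\<Sum>i. emeasure (Q n) (E i))"
      using Em by (intro emeasure_subadditive_countably) auto
    also have "\<dots> \<le> (\<Sum>i. ennreal (e * (1/2) ^ Suc i))"
    proof (intro suminf_le)
      fix i
      have "emeasure (Q n) (E i) \<le> emeasure (Q n) {z. r i < c x0 (fst (z i))} + emeasure (Q n) {z. r i < c x0 (snd (z i))}"
        unfolding E_def using meas[of i] sp borel_measurable_less[of "\<lambda>_. r i" "Q n"]
        by (intro emeasure_subadditive) auto
      also have "\<dots> \<le> ennreal (e * (1/2) ^ (i + 2)) + ennreal (e * (1/2) ^ (i + 2))"
        by (intro add_mono Markov meas B)
      also have "\<dots> = ennreal (e * (1/2) ^ Suc i)"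
        using e by (simp flip: ennreal_plus)
      finally show "emeasure (Q n) (E i) \<le> ennreal (e * (1/2) ^ Suc i)" .
    qed auto
    also have "\<dots> = ennreal e"
      using sums_mult[OF power_half_series, of e] e by (intro suminf_ennreal_eq) auto
    finally have "measure (Q n) (\<Union>i. E i) \<le> e"
      using e by (simp add: emeasure_eq_measure)
    moreover have "measure (Q n) (UNIV - (\<Union>i. E i)) = 1 - measure (Q n) (\<Union>i. E i)"
      using prob_compl[of "\<Union>i. E i"] Em sp by auto
    moreover have "UNIV - (\<Union>i. E i) = K"
      by (force simp: E_def K_def not_less simp flip: not_le)
    ultimately show ?thesis by simp
  qed
  with K show ?thesis by blast
qed

section \<open>Symmetrized couplings\<close>

text \<open>Coordinates \<open>i \<ge> M\<close> are filled with \<open>(x0, x0)\<close>, which has zero cost, so that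
  couplings for different \<open>M\<close> live on one space.\<close>

definition spread :: "'a \<Rightarrow> nat \<Rightarrow> (nat \<Rightarrow> nat) \<Rightarrow> (nat \<Rightarrow> 'a) \<times> (nat \<Rightarrow> 'a) \<Rightarrow> nat \<Rightarrow> 'a \<times> 'a" where
  "spread x0 M \<sigma> w = (\<lambda>i. if i < M then (fst w (\<sigma> i), snd w (\<sigma> i)) else (x0, x0))"

text \<open>Points of \<open>prodX M\<close> are \<open>undefined\<close> from \<open>M\<close> on.
  Replacing that value by \<open>x0\<close> turns their laws into Borel measures on the one space of
  all sequences, where limits are formed.\<close>

definition pad :: "'a \<Rightarrow> nat \<Rightarrow> (nat \<Rightarrow> 'a) \<Rightarrow> nat \<Rightarrow> 'a" where
  "pad x0 M x = (\<lambda>i. if i < M then x i else x0)"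

abbreviation perms :: "nat \<Rightarrow> (nat \<Rightarrow> nat) set" where
  "perms M \<equiv> {\<sigma>. \<sigma> permutes {..<M}}"

text \<open>\<open>R\<close> is the mean of the images of \<open>\<pi>\<close> under all
  \<open>spread x0 M \<sigma>\<close>. Since one \<sigma> acts on both blocks, paired coordinates
  stay paired and the coupling cost is kept.\<close>

definition symmetrization :: "'a::topological_space \<Rightarrow> nat \<Rightarrow> ((nat \<Rightarrow> 'a) \<times> (nat \<Rightarrow> 'a)) measure
    \<Rightarrow> (nat \<Rightarrow> 'a \<times> 'a) measure \<Rightarrow> bool" where
  "symmetrization x0 M \<pi> R \<longleftrightarrow> prob_space R \<and> sets R = sets borel \<and>
     (\<forall>f\<in>borel_measurable borel. (\<integral>\<^sup>+ z. f z \<partial>R) =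
        (\<Sum>\<sigma>\<in>perms M. \<integral>\<^sup>+ w. f (spread x0 M \<sigma> w) \<partial>\<pi>) / ennreal (real (card (perms M))))"

lemma perms_finite: "finite (perms M)"
  by (rule finite_permutations) simp

lemma perms_nonempty: "perms M \<noteq> {}"
  using permutes_id[of "{..<M}"] by blast

lemma card_perms: "card (perms M) = fact M"
  by (rule card_permutations) auto

lemma permutes_lessThan_less: "\<sigma> permutes {..<M} \<Longrightarrow> i < M \<Longrightarrow> \<sigma> i < M"
  using permutes_in_image[of \<sigma> "{..<M}" i] by simp

lemma measurable_prodX_component: "i < M \<Longrightarrow> (\<lambda>x. x i) \<in> measurable (prodX M) borel"
  by (rule measurable_component_singleton) simp

lemma pad_measurable:
  "pad x0 M \<in> measurable (prodX M) (borel :: (nat \<Rightarrow> 'a::second_countable_topology) measure)"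
proof (rule measurable_coordinatewise_then_product)
  fix i show "(\<lambda>x. pad x0 M x i) \<in> borel_measurable (prodX M)"
    by (cases "i < M") (auto simp: pad_def measurable_prodX_component)
qed

lemma spread_measurable:
  fixes x0 :: "'a::second_countable_topology"
  assumes "\<sigma> permutes {..<M}"
  shows "spread x0 M \<sigma> \<in> measurable (prodX M \<Otimes>\<^sub>M prodX M) borel"
proof (rule measurable_coordinatewise_then_product)
  fix i show "(\<lambda>w. spread x0 M \<sigma> w i) \<in> borel_measurable (prodX M \<Otimes>\<^sub>M prodX M)"
  proof (cases "i < M")
    case True
    then have i: "\<sigma> i < M"
      using permutes_lessThan_less[OF assms] by simp
    show ?thesis
      unfolding spread_def using True
      by (auto intro!: borel_measurable_Pair measurable_compose[OF measurable_fst measurable_prodX_component[OF i]]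
            measurable_compose[OF measurable_snd measurable_prodX_component[OF i]])
  qed (simp add: spread_def)
qed

lemma symmetrization_exists:
  fixes x0 :: "'a::second_countable_topology"
  assumes \<pi>: "prob_space \<pi>" "sets \<pi> = sets (prodX M \<Otimes>\<^sub>M prodX M)"
  obtains R where "symmetrization x0 M \<pi> R"
proof -
  have "spread x0 M \<sigma> \<in> measurable \<pi> borel" if "\<sigma> \<in> perms M" for \<sigma>
    using spread_measurable[of \<sigma> M x0] that measurable_cong_sets[OF \<pi>(2) refl] by blast
  then obtain R where "prob_space R" "sets R = sets borel"
    "\<And>f. f \<in> borel_measurable borel \<Longrightarrow>
      (\<integral>\<^sup>+ z. f z \<partial>R) = (\<Sum>\<sigma>\<in>perms M. \<integral>\<^sup>+ w. f (spread x0 M \<sigma> w) \<partial>\<pi>) / ennreal (real (card (perms M)))"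
    using finite_mixture[OF \<pi>(1) perms_finite perms_nonempty, of M "spread x0 M" borel] by blast
  then show ?thesis
    using that unfolding symmetrization_def by blast
qed

lemma spread_compose:
  assumes "\<tau> permutes {..<K}" "K \<le> M"
  shows "spread x0 M \<sigma> w \<circ> \<tau> = spread x0 M (\<sigma> \<circ> \<tau>) w"
proof -
  have "\<tau> permutes {..<M}"
    using assms by (auto intro: permutes_subset)
  then have "\<tau> i < M \<longleftrightarrow> i < M" for i
    using permutes_in_image[of \<tau> "{..<M}" i] by simp
  then show ?thesis
    by (auto simp: spread_def fun_eq_iff)
qed

lemma continuous_on_reindex:
  "continuous_on UNIV (\<lambda>z :: nat \<Rightarrow> 'b::topological_space. z \<circ> \<tau>)"
  by (intro continuous_on_coordinatewise_then_product) (simp add: comp_def)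

text \<open>Right composition with \<tau> merely rearranges the permutations over which the average
  is taken. As \<tau> fixes all indices from \<open>K\<close> on, it also respects the padding
  beyond \<open>M\<close>.\<close>

lemma symmetrization_perm_invariant:
  assumes R: "symmetrization x0 M \<pi> R" and \<tau>: "\<tau> permutes {..<K}" "K \<le> M"
  shows "distr R borel (\<lambda>z. z \<circ> \<tau>) = R"
proof -
  have sR: "sets R = sets borel"
    and int: "\<And>f. f \<in> borel_measurable borel \<Longrightarrow>
      (\<integral>\<^sup>+ z. f z \<partial>R) = (\<Sum>\<sigma>\<in>perms M. \<integral>\<^sup>+ w. f (spread x0 M \<sigma> w) \<partial>\<pi>) / ennreal (real (card (perms M)))"
    using R unfolding symmetrization_def by auto
  have \<tau>m: "(\<lambda>z. z \<circ> \<tau>) \<in> measurable borel borel"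
    by (intro borel_measurable_continuous_onI continuous_on_reindex)
  then have \<tau>mR: "(\<lambda>z. z \<circ> \<tau>) \<in> measurable R borel"
    using measurable_cong_sets[OF sR refl] by blast
  have \<tau>M: "\<tau> permutes {..<M}"
    using \<tau> by (auto intro: permutes_subset)
  show ?thesis
  proof (rule measure_eqI)
    fix A assume "A \<in> sets (distr R borel (\<lambda>z. z \<circ> \<tau>))"
    then have A: "A \<in> sets borel" by simp
    have "emeasure (distr R borel (\<lambda>z. z \<circ> \<tau>)) A = (\<integral>\<^sup>+ z. indicator A (z \<circ> \<tau>) \<partial>R)"
      using A \<tau>mR by (simp add: nn_integral_distr flip: nn_integral_indicator)
    also have "\<dots> = (\<Sum>\<sigma>\<in>perms M. \<integral>\<^sup>+ w. indicator A (spread x0 M \<sigma> w \<circ> \<tau>) \<partial>\<pi>) / ennreal (real (card (perms M)))"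
      using A measurable_compose[OF \<tau>m, of "indicator A" borel] by (intro int) auto
    also have "(\<Sum>\<sigma>\<in>perms M. \<integral>\<^sup>+ w. indicator A (spread x0 M \<sigma> w \<circ> \<tau>) \<partial>\<pi>)
      = (\<Sum>\<sigma>\<in>perms M. \<integral>\<^sup>+ w. indicator A (spread x0 M \<sigma> w) \<partial>\<pi>)"
      unfolding spread_compose[OF \<tau>]
      by (rule sum_permutations_compose_right[OF \<tau>M, symmetric, of "\<lambda>\<sigma>. \<integral>\<^sup>+ w. indicator A (spread x0 M \<sigma> w) \<partial>\<pi>"])
    also have "(\<Sum>\<sigma>\<in>perms M. \<integral>\<^sup>+ w. indicator A (spread x0 M \<sigma> w) \<partial>\<pi>) / ennreal (real (card (perms M))) = (\<integral>\<^sup>+ z. indicator A z \<partial>R)"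
      using A by (intro int[symmetric]) auto
    also have "\<dots> = emeasure R A"
      using A sR by simp
    finally show "emeasure (distr R borel (\<lambda>z. z \<circ> \<tau>)) A = emeasure R A" .
  qed (simp add: sR)
qed

text \<open>Distinct coordinates of an independent family with common law are again such a family;
  injectivity of \<sigma> makes them distinct.\<close>

lemma distr_prob_PiM_restrict:
  fixes K M :: nat
  assumes P: "prob_space P" and \<sigma>: "\<sigma> permutes {..<M}" and K: "K \<le> M"
  shows "distr (PiM {..<M} (\<lambda>_. P)) (PiM {..<K} (\<lambda>_. P)) (\<lambda>y. \<lambda>i\<in>{..<K}. y (\<sigma> i)) = PiM {..<K} (\<lambda>_. P)"
proof (rule distr_PiM_reindex)
  show "inj_on \<sigma> {..<K}"
    using permutes_inj[OF \<sigma>] by (rule inj_on_subset) simp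
  show "\<sigma> \<in> {..<K} \<rightarrow> {..<M}"
    using permutes_lessThan_less[OF \<sigma>] K by simp
qed (rule P)

lemma nn_integral_const_mixture:
  assumes "\<And>\<sigma>. \<sigma> \<in> perms M \<Longrightarrow> g \<sigma> = (t :: ennreal)"
  shows "(\<Sum>\<sigma>\<in>perms M. g \<sigma>) / ennreal (real (card (perms M))) = t"
proof -
  have "0 < real (card (perms M))"
    by (simp add: card_perms)
  moreover have "(\<Sum>\<sigma>\<in>perms M. g \<sigma>) = ennreal (real (card (perms M))) * t"
    using assms by (simp add: ennreal_of_nat_eq_real_of_nat)
  ultimately show ?thesis
    by (simp add: ennreal_mult_divide_eq mult.commute)
qed

text \<open>Every \<sigma> contributes the same law, since any \<open>K\<close> distinct coordinates
  of the product measure have the product law again. Padding makes the marginal a Borel measure that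
  depends on \<open>K\<close> but not on \<open>M\<close>, hence a constant sequence in the
  limit.\<close>

lemma symmetrization_snd_marginal:
  fixes x0 :: "'a::second_countable_topology"
  assumes R: "symmetrization x0 M \<pi> R" and \<pi>: "\<pi> \<in> couplings Pb (PiM {..<M} (\<lambda>_. P))"
    and Pb: "sets Pb = sets (prodX M)" and P: "prob_space P" "sets P = sets borel" and "K \<le> M"
  shows "distr R borel (\<lambda>z i. if i < K then snd (z i) else x0) = distr (PiM {..<K} (\<lambda>_. P)) borel (pad x0 K)"
proof -
  let ?Y = "\<lambda>(z :: nat \<Rightarrow> 'a \<times> 'a) i. if i < K then snd (z i) else x0"
  have sR: "sets R = sets borel"
    and int: "\<And>f. f \<in> borel_measurable borel \<Longrightarrow>
      (\<integral>\<^sup>+ z. f z \<partial>R) = (\<Sum>\<sigma>\<in>perms M. \<integral>\<^sup>+ w. f (spread x0 M \<sigma> w) \<partial>\<pi>) / ennreal (real (card (perms M)))"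
    using R unfolding symmetrization_def by auto
  have sP: "sets (PiM {..<k} (\<lambda>_. P)) = sets (prodX k)" for k
    using P(2) by (intro sets_PiM_cong) auto
  have s\<pi>: "sets \<pi> = sets (prodX M \<Otimes>\<^sub>M prodX M)"
    using \<pi> Pb sP[of M] sets_pair_measure_cong[of Pb "prodX M"] by (auto simp: couplings_def)
  have snd\<pi>: "distr \<pi> (PiM {..<M} (\<lambda>_. P)) snd = PiM {..<M} (\<lambda>_. P)"
    using \<pi> by (simp add: couplings_def)
  have Ym: "?Y \<in> measurable borel borel"
  proof (rule borel_measurable_continuous_onI, rule continuous_on_coordinatewise_then_product)
    show "continuous_on UNIV (\<lambda>z. ?Y z i)" for i
      by (cases "i < K") (auto intro!: continuous_intros)
  qed
  then have YmR: "?Y \<in> measurable R borel"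
    using measurable_cong_sets[OF sR refl] by blast
  have padm: "pad x0 K \<in> measurable (PiM {..<K} (\<lambda>_. P)) borel"
    using pad_measurable measurable_cong_sets[OF sP refl] by blast
  show ?thesis
  proof (rule measure_eqI)
    fix A assume "A \<in> sets (distr R borel ?Y)"
    then have A: "A \<in> sets borel" by simp
    let ?\<nu> = "distr (PiM {..<K} (\<lambda>_. P)) borel (pad x0 K)"
    have "emeasure (distr R borel ?Y) A = (\<integral>\<^sup>+ z. indicator A (?Y z) \<partial>R)"
      using A YmR by (simp add: nn_integral_distr flip: nn_integral_indicator)
    also have "\<dots> = (\<Sum>\<sigma>\<in>perms M. \<integral>\<^sup>+ w. indicator A (?Y (spread x0 M \<sigma> w)) \<partial>\<pi>) / ennreal (real (card (perms M)))"
      using A Ym by (intro int) auto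
    also have "\<dots> = emeasure ?\<nu> A"
    proof (rule nn_integral_const_mixture)
      fix \<sigma> assume "\<sigma> \<in> perms M"
      then have \<sigma>: "\<sigma> permutes {..<M}" by simp
      let ?r = "\<lambda>y. \<lambda>i\<in>{..<K}. y (\<sigma> i)"
      have rm: "?r \<in> measurable (PiM {..<M} (\<lambda>_. P)) (PiM {..<K} (\<lambda>_. P))"
        using permutes_lessThan_less[OF \<sigma>] \<open>K \<le> M\<close>
        by (intro measurable_restrict measurable_component_singleton) auto
      have sndm: "snd \<in> measurable \<pi> (PiM {..<M} (\<lambda>_. P))"
        using measurable_cong_sets[OF s\<pi> sP[of M]] measurable_snd[of "prodX M" "prodX M"] by blast
      have "(\<integral>\<^sup>+ w. indicator A (?Y (spread x0 M \<sigma> w)) \<partial>\<pi>) = (\<integral>\<^sup>+ w. indicator A (pad x0 K (?r (snd w))) \<partial>\<pi>)"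
        using \<open>K \<le> M\<close> by (intro nn_integral_cong arg_cong[where f = "indicator A"]) (auto simp: spread_def pad_def)
      also have "\<dots> = (\<integral>\<^sup>+ y. indicator A (pad x0 K y) \<partial>distr (distr \<pi> (PiM {..<M} (\<lambda>_. P)) snd) (PiM {..<K} (\<lambda>_. P)) ?r)"
        using A sndm rm padm
        by (subst nn_integral_distr, simp, simp, subst nn_integral_distr) auto
      also have "\<dots> = (\<integral>\<^sup>+ y. indicator A (pad x0 K y) \<partial>PiM {..<K} (\<lambda>_. P))"
        unfolding snd\<pi> distr_prob_PiM_restrict[OF P(1) \<sigma> \<open>K \<le> M\<close>] ..
      also have "\<dots> = emeasure ?\<nu> A"
        using A padm by (simp add: nn_integral_distr flip: nn_integral_indicator)
      finally show "(\<integral>\<^sup>+ w. indicator A (?Y (spread x0 M \<sigma> w)) \<partial>\<pi>) = emeasure ?\<nu> A" .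
    qed
    finally show "emeasure (distr R borel ?Y) A = emeasure ?\<nu> A" .
  qed simp
qed

lemma symmetrization_snd_integral:
  fixes x0 :: "'a::second_countable_topology" and h :: "'a \<Rightarrow> ennreal"
  assumes R: "symmetrization x0 M \<pi> R" and \<pi>: "\<pi> \<in> couplings Pb (PiM {..<M} (\<lambda>_. P))"
    and Pb: "sets Pb = sets (prodX M)" and P: "prob_space P" "sets P = sets borel"
    and h: "h \<in> borel_measurable borel" and i: "i < M"
  shows "(\<integral>\<^sup>+ z. h (snd (z i)) \<partial>R) = (\<integral>\<^sup>+ x. h x \<partial>P)"
proof -
  let ?Y = "\<lambda>(z :: nat \<Rightarrow> 'a \<times> 'a) j. if j < M then snd (z j) else x0"
  have sR: "sets R = sets borel"
    using R unfolding symmetrization_def by auto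
  have sP: "sets (PiM {..<M} (\<lambda>_. P)) = sets (prodX M)"
    using P(2) by (intro sets_PiM_cong) auto
  have Ym: "?Y \<in> measurable R borel"
  proof -
    have "continuous_on UNIV ?Y"
    proof (rule continuous_on_coordinatewise_then_product)
      show "continuous_on UNIV (\<lambda>z. ?Y z j)" for j
        by (cases "j < M") (auto intro!: continuous_intros)
    qed
    then show ?thesis
      using borel_measurable_continuous_onI measurable_cong_sets[OF sR refl] by blast
  qed
  have padm: "pad x0 M \<in> measurable (PiM {..<M} (\<lambda>_. P)) borel"
    using pad_measurable measurable_cong_sets[OF sP refl] by blast
  have hm: "(\<lambda>y :: nat \<Rightarrow> 'a. h (y i)) \<in> borel_measurable borel"
    using measurable_compose[OF borel_measurable_continuous_onI[OF continuous_on_product_coordinates] h] .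
  have "(\<integral>\<^sup>+ z. h (snd (z i)) \<partial>R) = (\<integral>\<^sup>+ y. h (y i) \<partial>distr R borel ?Y)"
    using Ym hm i by (simp add: nn_integral_distr)
  also have "\<dots> = (\<integral>\<^sup>+ y. h (y i) \<partial>PiM {..<M} (\<lambda>_. P))"
    unfolding symmetrization_snd_marginal[OF R \<pi> Pb P order_refl]
    using padm hm i by (simp add: nn_integral_distr pad_def)
  also have "\<dots> = (\<integral>\<^sup>+ x. h x \<partial>distr (PiM {..<M} (\<lambda>_. P)) P (\<lambda>y. y i))"
    using h i measurable_cong_sets[OF P(2) refl]
    by (intro nn_integral_distr[symmetric] measurable_component_singleton) auto
  also have "distr (PiM {..<M} (\<lambda>_. P)) P (\<lambda>y. y i) = P"
    using i P(1) by (intro distr_PiM_component) auto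
  finally show ?thesis .
qed

text \<open>Transpositions show that all \<open>M\<close> coordinate costs are equal, and their sum
  is the total cost under \<open>\<pi>\<close> because a permutation only reorders the terms of
  \<open>costM\<close>.\<close>

lemma symmetrization_cost:
  fixes c :: "'a::second_countable_topology \<Rightarrow> 'a \<Rightarrow> real"
  assumes c: "proper_cost c" and R: "symmetrization x0 M \<pi> R" and s\<pi>: "sets \<pi> = sets (prodX M \<Otimes>\<^sub>M prodX M)"
    and cost: "(\<integral>\<^sup>+ w. ennreal (costM c M (fst w) (snd w)) \<partial>\<pi>) \<le> ennreal B" and i: "i < M"
  shows "(\<integral>\<^sup>+ z. ennreal (c (fst (z i)) (snd (z i))) \<partial>R) \<le> ennreal (B / real M)"
proof -
  have sR: "sets R = sets borel"
    and int: "\<And>f. f \<in> borel_measurable borel \<Longrightarrow>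
      (\<integral>\<^sup>+ z. f z \<partial>R) = (\<Sum>\<sigma>\<in>perms M. \<integral>\<^sup>+ w. f (spread x0 M \<sigma> w) \<partial>\<pi>) / ennreal (real (card (perms M)))"
    using R unfolding symmetrization_def by auto
  have cm: "(\<lambda>z. c (fst (z j)) (snd (z j))) \<in> borel_measurable borel" for j :: nat
    by (intro proper_cost_measurable[OF c] borel_measurable_continuous_onI continuous_intros) auto
  define g where "g j = (\<integral>\<^sup>+ z. ennreal (c (fst (z j)) (snd (z j))) \<partial>R)" for j
  have g_eq: "g j = g i" if "j < M" for j
  proof -
    have \<tau>: "Transposition.transpose i j permutes {..<M}"
      using i that by (intro permutes_swap_id) auto
    have \<tau>m: "(\<lambda>z. z \<circ> Transposition.transpose i j) \<in> measurable R borel"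
      using borel_measurable_continuous_onI[OF continuous_on_reindex] measurable_cong_sets[OF sR refl] by blast
    have "g i = (\<integral>\<^sup>+ z. ennreal (c (fst (z i)) (snd (z i))) \<partial>distr R borel (\<lambda>z. z \<circ> Transposition.transpose i j))"
      unfolding g_def symmetrization_perm_invariant[OF R \<tau> order_refl] ..
    also have "\<dots> = g j"
      unfolding g_def using cm[of i] \<tau>m by (subst nn_integral_distr) auto
    finally show ?thesis by simp
  qed
  have nonneg: "0 \<le> c x y" for x y
    using c by (rule proper_cost_nonneg)
  have cMm: "(\<lambda>z. costM c M (fst \<circ> z) (snd \<circ> z)) \<in> borel_measurable borel"
    unfolding costM_def comp_def by (intro borel_measurable_sum cm)
  have "ennreal (real M) * g i = (\<Sum>j<M. g j)"
    using g_eq by (simp add: ennreal_of_nat_eq_real_of_nat)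
  also have "\<dots> = (\<integral>\<^sup>+ z. ennreal (costM c M (fst \<circ> z) (snd \<circ> z)) \<partial>R)"
    unfolding g_def costM_def comp_def using cm measurable_cong_sets[OF sR refl] nonneg
    by (subst nn_integral_sum[symmetric]) (auto simp: sum_ennreal)
  also have "\<dots> = (\<Sum>\<sigma>\<in>perms M. \<integral>\<^sup>+ w. ennreal (costM c M (fst \<circ> spread x0 M \<sigma> w) (snd \<circ> spread x0 M \<sigma> w)) \<partial>\<pi>)
      / ennreal (real (card (perms M)))"
    using cMm by (intro int) auto
  also have "\<dots> = (\<integral>\<^sup>+ w. ennreal (costM c M (fst w) (snd w)) \<partial>\<pi>)"
  proof (rule nn_integral_const_mixture)
    fix \<sigma> assume "\<sigma> \<in> perms M"
    then have "bij_betw \<sigma> {..<M} {..<M}"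
      by (simp add: permutes_imp_bij)
    then have "costM c M (fst \<circ> spread x0 M \<sigma> w) (snd \<circ> spread x0 M \<sigma> w) = costM c M (fst w) (snd w)" for w
      unfolding costM_def spread_def by (simp add: sum.reindex_bij_betw[of \<sigma> "{..<M}" "{..<M}" "\<lambda>j. c (fst w j) (snd w j)"])
    then show "(\<integral>\<^sup>+ w. ennreal (costM c M (fst \<circ> spread x0 M \<sigma> w) (snd \<circ> spread x0 M \<sigma> w)) \<partial>\<pi>)
      = (\<integral>\<^sup>+ w. ennreal (costM c M (fst w) (snd w)) \<partial>\<pi>)" by simp
  qed
  finally have *: "ennreal (real M) * g i \<le> ennreal B"
    using cost by simp
  have "g i = ennreal (1 / real M) * (ennreal (real M) * g i)"
    using i by (simp add: mult.assoc[symmetric] flip: ennreal_mult')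
  also have "\<dots> \<le> ennreal (1 / real M) * ennreal B"
    using * by (rule mult_left_mono) simp
  also have "\<dots> = ennreal (B / real M)"
    by (simp flip: ennreal_mult')
  finally show ?thesis
    unfolding g_def .
qed

lemma symmetrization_padding:
  fixes x0 :: "'a::second_countable_topology" and h :: "'a \<times> 'a \<Rightarrow> ennreal"
  assumes R: "symmetrization x0 M \<pi> R" and h: "h \<in> borel_measurable borel" "h (x0, x0) = 0" and i: "M \<le> i"
  shows "(\<integral>\<^sup>+ z. h (z i) \<partial>R) = 0"
proof -
  have "(\<lambda>z. h (z i)) \<in> borel_measurable borel"
    using measurable_compose[OF borel_measurable_continuous_onI[OF continuous_on_product_coordinates] h(1)] .
  then have "(\<integral>\<^sup>+ z. h (z i) \<partial>R) = (\<Sum>\<sigma>\<in>perms M. \<integral>\<^sup>+ w. h (spread x0 M \<sigma> w i) \<partial>\<pi>) / ennreal (real (card (perms M)))"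
    using R unfolding symmetrization_def by auto
  also have "\<dots> = 0"
    using i h(2) by (simp add: spread_def)
  finally show ?thesis .
qed

section \<open>Symmetric transport balls\<close>

locale symmetric_transport_ball =
  fixes c :: "'a::polish_space \<Rightarrow> 'a \<Rightarrow> real" and Phat :: "'a measure" and \<rho> :: real and N :: nat
    and loss :: "(nat \<Rightarrow> 'a) \<Rightarrow> real"
  assumes cost: "proper_cost c"
    and Phat: "prob_space Phat" "sets Phat = sets borel" "finite_moment c Phat"
    and rho: "0 < \<rho>" and N: "1 \<le> N"
    and usc: "usc_on (prodTop N) loss" and growth: "loss \<in> growth_class c N"
begin

lemma cost_nonneg: "0 \<le> c x y"
  using cost by (rule proper_cost_nonneg)

lemma costM_nonneg: "0 \<le> costM c K x y"
  by (simp add: costM_def sum_nonneg cost_nonneg)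

lemma triangle: "\<exists>C\<ge>1. \<forall>x y z. c x z \<le> C * (c x y + c y z)"
  using cost unfolding proper_cost_def by blast

lemma cost_sym: "c x y = c y x" and cost_refl: "c x x = 0"
  using cost unfolding proper_cost_def by blast+

lemma sets_PiM_Phat: "sets (PiM {..<K} (\<lambda>_. Phat)) = sets (prodX K)"
  using Phat(2) by (intro sets_PiM_cong) auto

text \<open>Semi-continuity is assumed on extensional functions only; \<open>proj N\<close> maps
  arbitrary sequences continuously to these.\<close>

lemma loss_lsc: "lsc (\<lambda>x. - loss (proj N x))"
proof (rule usc_on_compose[OF usc])
  show "continuous_map euclidean (prodTop N) (proj N :: (nat \<Rightarrow> 'a) \<Rightarrow> _)"
    unfolding continuous_map_componentwise proj_def by (auto simp: continuous_map_iff_continuous2)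
qed

lemma loss_measurable: "(\<lambda>x. loss (proj N x)) \<in> borel_measurable borel"
  using borel_measurable_uminus[OF lsc_borel_measurable[OF loss_lsc]] by simp

lemma loss_measurable_prodX:
  assumes "N \<le> M" "\<sigma> permutes {..<M}"
  shows "(\<lambda>x. loss (proj N (x \<circ> \<sigma>))) \<in> borel_measurable (prodX M)"
proof -
  \<comment> \<open>The detour through the sequence space makes Borel measurability of the loss
    available. The filler is never read, because \<sigma> keeps the indices below \<open>N\<close>
    inside \<open>{..<M}\<close>.\<close>
  have "(\<lambda>x. pad undefined M x \<circ> \<sigma>) \<in> measurable (prodX M) (borel :: (nat \<Rightarrow> 'a) measure)"
    using measurable_compose[OF pad_measurable borel_measurable_continuous_onI[OF continuous_on_reindex]] .
  from measurable_compose[OF this loss_measurable]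
  have "(\<lambda>x. loss (proj N (pad undefined M x \<circ> \<sigma>))) \<in> borel_measurable (prodX M)" .
  moreover have "proj N (pad undefined M x \<circ> \<sigma>) = proj N (x \<circ> \<sigma>)" for x :: "nat \<Rightarrow> 'a"
    using assms permutes_lessThan_less[OF assms(2)] by (auto simp: proj_def pad_def fun_eq_iff restrict_def)
  ultimately show ?thesis by simp
qed

lemma loss_borel_measurable_prodX: "loss \<in> borel_measurable (prodX N)"
proof -
  have "(\<lambda>x. loss (proj N (x \<circ> id))) \<in> borel_measurable (prodX N)"
    by (intro loss_measurable_prodX permutes_id order_refl)
  moreover have "proj N (x \<circ> id) = x" if "x \<in> space (prodX N)" for x :: "nat \<Rightarrow> 'a"
    using that by (auto simp: proj_def space_PiM PiE_iff extensional_restrict)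
  ultimately show ?thesis
    by (subst measurable_cong[where g = "\<lambda>x. loss (proj N (x \<circ> id))"]) auto
qed

text \<open>The order of quantifiers matters: \<open>xh\<close> is fixed before \<epsilon>, so that
  cost integrals relative to \<open>xh\<close> have one bound while \<epsilon> tends to 0.\<close>

lemma loss_growth: "\<exists>xh. \<forall>\<epsilon>>0. \<exists>D\<ge>0. \<forall>x. loss (proj N x) \<le> D + \<epsilon> * costM c N xh x"
proof -
  obtain k \<delta> xh where k: "0 < k" and \<delta>: "gaugeD \<delta>"
    and le: "\<And>x. x \<in> topspace (prodTop N) \<Longrightarrow> loss x \<le> k * (1 + \<delta> (costM c N xh x))"
    using growth unfolding growth_class_def by blast
  have "\<exists>D\<ge>0. \<forall>x. loss (proj N x) \<le> D + \<epsilon> * costM c N xh x" if \<epsilon>: "0 < \<epsilon>" for \<epsilon>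
  proof -
    \<comment> \<open>Taking \<open>\<epsilon> / k\<close> compensates the factor \<open>k\<close>
      of the growth bound.\<close>
    obtain D where D: "0 \<le> D" "\<And>r. 0 \<le> r \<Longrightarrow> \<delta> r \<le> D + \<epsilon> / k * r"
      using gauge_linear_bound[OF \<delta> divide_pos_pos[OF \<epsilon> k]] by blast
    have "loss (proj N x) \<le> k * (1 + D) + \<epsilon> * costM c N xh x" for x
    proof -
      have "costM c N xh (proj N x) = costM c N xh x"
        by (simp add: costM_def proj_def)
      then have "loss (proj N x) \<le> k * (1 + \<delta> (costM c N xh x))"
        using le[of "proj N x"] by (simp add: proj_def)
      also have "\<dots> \<le> k * (1 + (D + \<epsilon> / k * costM c N xh x))"
        using k D(2)[OF costM_nonneg] by (intro mult_left_mono add_left_mono) auto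
      also have "\<dots> = k * (1 + D) + \<epsilon> * costM c N xh x"
        using k by (simp add: algebra_simps)
      finally show ?thesis .
    qed
    then show ?thesis
      using k D(1) by (intro exI[of _ "k * (1 + D)"]) auto
  qed
  then show ?thesis by blast
qed

text \<open>Linear growth (\<epsilon> = 1) suffices here: the weak triangle inequality moves the
  reference point from \<open>xh\<close> to the point \<open>y\<close> at which the moment is
  finite, at the price of the constant \<open>E\<close>.\<close>

lemma loss_positive_part_finite:
  assumes Pb: "prob_space Pb" "sets Pb = sets (prodX M)" "finite_moment (costM c M) Pb"
    and M: "N \<le> M" and \<sigma>: "\<sigma> permutes {..<M}"
  shows "(\<integral>\<^sup>+ x. ennreal (loss (proj N (x \<circ> \<sigma>))) \<partial>Pb) < \<infinity>"
proof -
  interpret prob_space Pb by fact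
  obtain y where y: "(\<integral>\<^sup>+ x. ennreal (costM c M y x) \<partial>Pb) < \<infinity>"
    using Pb(3) by (auto simp: finite_moment_def)
  obtain C where C: "C \<ge> 1" "\<And>x y z. c x z \<le> C * (c x y + c y z)"
    using triangle by blast
  obtain xh where xh: "\<And>\<epsilon>. 0 < \<epsilon> \<Longrightarrow> \<exists>D\<ge>0. \<forall>x. loss (proj N x) \<le> D + \<epsilon> * costM c N xh x"
    using loss_growth by blast
  obtain D where D: "0 \<le> D" "\<And>x. loss (proj N x) \<le> D + 1 * costM c N xh x"
    using xh[of 1] by auto
  define E where "E = (\<Sum>i<N. C * c (xh i) (y (\<sigma> i)))"
  have "0 \<le> E"
    unfolding E_def using C(1) cost_nonneg by (intro sum_nonneg mult_nonneg_nonneg) auto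
  \<comment> \<open>Each of the \<open>N\<close> coordinate costs is bounded by the full
    \<open>costM c M y x\<close>, hence the factor \<open>real N * C\<close>.\<close>
  have bound: "loss (proj N (x \<circ> \<sigma>)) \<le> (D + E) + (real N * C) * costM c M y x" for x
  proof -
    have "costM c N xh (x \<circ> \<sigma>) \<le> (\<Sum>i<N. C * c (xh i) (y (\<sigma> i)) + C * costM c M y x)"
      unfolding costM_def[of c N]
    proof (rule sum_mono)
      fix i assume "i \<in> {..<N}"
      then have "\<sigma> i < M"
        using permutes_lessThan_less[OF \<sigma>] M by simp
      then have "c (y (\<sigma> i)) (x (\<sigma> i)) \<le> costM c M y x"
        unfolding costM_def using member_le_sum[of "\<sigma> i" "{..<M}" "\<lambda>j. c (y j) (x j)"] cost_nonneg by auto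
      then have "C * c (y (\<sigma> i)) (x (\<sigma> i)) \<le> C * costM c M y x"
        using C(1) by (intro mult_left_mono) auto
      with C(2)[of "xh i" "x (\<sigma> i)" "y (\<sigma> i)"]
      show "c (xh i) ((x \<circ> \<sigma>) i) \<le> C * c (xh i) (y (\<sigma> i)) + C * costM c M y x"
        unfolding comp_apply distrib_left by linarith
    qed
    also have "\<dots> = E + real N * C * costM c M y x"
      by (simp add: E_def sum.distrib)
    finally show ?thesis
      using D(2)[of "x \<circ> \<sigma>"] by simp
  qed
  have meas: "(\<lambda>x. ennreal (costM c M y x)) \<in> borel_measurable Pb"
  proof -
    have "(\<lambda>x. costM c M y x) \<in> borel_measurable (prodX M)"
      unfolding costM_def
      by (intro borel_measurable_sum proper_cost_measurable[OF cost] measurable_prodX_component) auto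
    then have "(\<lambda>x. ennreal (costM c M y x)) \<in> borel_measurable (prodX M)"
      by (rule measurable_compose) simp
    then show ?thesis
      using measurable_cong_sets[OF Pb(2) refl] by blast
  qed
  have "(\<integral>\<^sup>+ x. ennreal (loss (proj N (x \<circ> \<sigma>))) \<partial>Pb)
      \<le> (\<integral>\<^sup>+ x. ennreal (D + E) + ennreal (real N * C) * ennreal (costM c M y x) \<partial>Pb)"
  proof (rule nn_integral_mono)
    fix x
    have "ennreal ((D + E) + (real N * C) * costM c M y x) = ennreal (D + E) + ennreal (real N * C) * ennreal (costM c M y x)"
      using D(1) \<open>0 \<le> E\<close> C(1) costM_nonneg[of M y x] by (simp add: ennreal_mult ennreal_plus)
    then show "ennreal (loss (proj N (x \<circ> \<sigma>))) \<le> ennreal (D + E) + ennreal (real N * C) * ennreal (costM c M y x)"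
      using bound[of x] by (metis ennreal_leI)
  qed
  also have "\<dots> = ennreal (D + E) + ennreal (real N * C) * (\<integral>\<^sup>+ x. ennreal (costM c M y x) \<partial>Pb)"
    using meas by (simp add: nn_integral_add nn_integral_cmult emeasure_space_1)
  also have "\<dots> < \<infinity>"
    using y by (auto simp: ennreal_mult_less_top)
  finally show ?thesis .
qed

lemma proj_measurable: "K \<le> M \<Longrightarrow> proj K \<in> measurable (prodX M) (prodX K)"
  unfolding proj_def by (intro measurable_restrict measurable_component_singleton) auto

lemma permute_measurable:
  assumes "\<sigma> permutes {..<M}"
  shows "(\<lambda>x. x \<circ> \<sigma>) \<in> measurable (prodX M) (prodX M :: (nat \<Rightarrow> 'a) measure)"
proof (rule measurable_PiM_single')
  show "(\<lambda>\<omega>. (\<omega> \<circ> \<sigma>) i) \<in> borel_measurable (prodX M)" if "i \<in> {..<M}" for i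
    using that permutes_lessThan_less[OF assms, of i] by (simp add: measurable_prodX_component)
  show "(\<lambda>\<omega>. \<omega> \<circ> \<sigma>) \<in> space (prodX M) \<rightarrow> {..<M} \<rightarrow>\<^sub>E space borel"
    using permutes_not_in[OF assms] by (auto simp: space_PiM PiE_iff extensional_def)
qed

section \<open>The symmetrized supremum as an upper bound\<close>

lemma expect_UM_le:
  assumes M: "N \<le> M" and P: "P \<in> UM c Phat \<rho> N M"
  shows "expect P loss \<le> Usym c Phat \<rho> N M loss"
proof -
  obtain Pb where Pb: "Pb \<in> wball c Phat \<rho> M" and inv: "perm_invariant M Pb"
    and P_eq: "P = distr Pb (prodX N) (proj N)"
    using P by (auto simp: UM_def wball_sym_def)
  have pb: "prob_space Pb" "sets Pb = sets (prodX M)" "finite_moment (costM c M) Pb"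
    using Pb by (auto simp: wball_def)
  have projm: "proj N \<in> measurable Pb (prodX N)"
    using proj_measurable[OF M] measurable_cong_sets[OF pb(2) refl] by blast
  have exp_eq: "expect P loss = expect Pb (\<lambda>x. loss (proj N x))"
    unfolding expect_def P_eq using projm loss_borel_measurable_prodX by (simp add: nn_integral_distr)
  have gm: "(\<lambda>x. loss (proj N (x \<circ> \<sigma>))) \<in> borel_measurable Pb" if "\<sigma> permutes {..<M}" for \<sigma>
    using loss_measurable_prodX[OF M that] measurable_cong_sets[OF pb(2) refl] by blast
  have fin: "(\<integral>\<^sup>+ x. ennreal (loss (proj N x)) \<partial>Pb) < \<infinity>"
    using loss_positive_part_finite[OF pb M permutes_id] by simp
  have "expect Pb (\<lambda>x. loss (proj N x)) \<le> expect Pb (symz M (loss \<circ> proj N))"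
  proof (rule dense_le)
    \<comment> \<open>Nothing lies below an expectation of minus infinity; otherwise a real
      \<open>a\<close> below it forces integrability, and real integrals can be averaged over the
      permutations.\<close>
    fix e assume e: "e < expect Pb (\<lambda>x. loss (proj N x))"
    then obtain a where a: "e < ereal a" "ereal a < expect Pb (\<lambda>x. loss (proj N x))"
      using ereal_dense2 by blast
    have int: "integrable Pb (\<lambda>x. loss (proj N x))" and agt: "a < (\<integral>x. loss (proj N x) \<partial>Pb)"
      by (rule expect_gt_imp_integrable[OF gm[OF permutes_id, unfolded comp_id] fin a(2)])+
    have \<sigma>int: "integrable Pb (\<lambda>x. loss (proj N (x \<circ> \<sigma>)))"
      "(\<integral>x. loss (proj N (x \<circ> \<sigma>)) \<partial>Pb) = (\<integral>x. loss (proj N x) \<partial>Pb)" if \<sigma>: "\<sigma> permutes {..<M}" for \<sigma>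
    proof -
      have pm: "(\<lambda>x. x \<circ> \<sigma>) \<in> measurable Pb (prodX M)"
        using permute_measurable[OF \<sigma>] measurable_cong_sets[OF pb(2) refl] by blast
      have Lm: "(\<lambda>x. loss (proj N x)) \<in> borel_measurable (prodX M)"
        using loss_measurable_prodX[OF M permutes_id] by simp
      have d: "distr Pb (prodX M) (\<lambda>x. x \<circ> \<sigma>) = Pb"
        using inv \<sigma> by (simp add: perm_invariant_def)
      show "integrable Pb (\<lambda>x. loss (proj N (x \<circ> \<sigma>)))"
        using int integrable_distr_eq[OF pm Lm] d by simp
      show "(\<integral>x. loss (proj N (x \<circ> \<sigma>)) \<partial>Pb) = (\<integral>x. loss (proj N x) \<partial>Pb)"
        using integral_distr[OF pm Lm] d by simp
    qed
    have symz_eq: "symz M (loss \<circ> proj N) = (\<lambda>x. (\<Sum>\<sigma>\<in>perms M. loss (proj N (x \<circ> \<sigma>))) / fact M)"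
      by (simp add: symz_def fun_eq_iff)
    have "integrable Pb (symz M (loss \<circ> proj N))"
      unfolding symz_eq using \<sigma>int(1)
      by (intro Bochner_Integration.integrable_divide Bochner_Integration.integrable_sum) simp_all
    moreover have "(\<integral>x. symz M (loss \<circ> proj N) x \<partial>Pb) = (\<integral>x. loss (proj N x) \<partial>Pb)"
    proof -
      have "(\<integral>x. symz M (loss \<circ> proj N) x \<partial>Pb) = (\<Sum>\<sigma>\<in>perms M. \<integral>x. loss (proj N (x \<circ> \<sigma>)) \<partial>Pb) / fact M"
        unfolding symz_eq using \<sigma>int(1) by (subst Bochner_Integration.integral_divide_zero)
          (simp add: Bochner_Integration.integral_sum)
      also have "(\<Sum>\<sigma>\<in>perms M. \<integral>x. loss (proj N (x \<circ> \<sigma>)) \<partial>Pb) = (\<Sum>\<sigma>\<in>perms M. \<integral>x. loss (proj N x) \<partial>Pb)"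
        using \<sigma>int(2) by (intro sum.cong) simp_all
      also have "\<dots> / fact M = (\<integral>x. loss (proj N x) \<partial>Pb)"
        by (simp add: card_perms)
      finally show ?thesis .
    qed
    ultimately show "e \<le> expect Pb (symz M (loss \<circ> proj N))"
      using a(1) agt less_trans[of e "ereal a" "ereal (\<integral>x. loss (proj N x) \<partial>Pb)"]
      by (simp add: expect_integrable less_imp_le)
  qed
  also have "\<dots> \<le> Usym c Phat \<rho> N M loss"
    unfolding Usym_def using Pb by (rule SUP_upper)
  finally show ?thesis
    unfolding exp_eq .
qed

section \<open>Approximating laws and their marginals\<close>

text \<open>The first block of \<open>spread x0 M \<sigma> w\<close> agrees below \<open>N\<close>
  with \<open>fst w \<circ> \<sigma>\<close>, so integrating the loss under \<open>R\<close>
  reproduces the average in \<open>symz\<close> under \<open>Pb\<close>. The real lower bound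
  \<open>a\<close> makes each permuted loss integrable.\<close>

lemma symmetrization_loss:
  assumes M: "N \<le> M" and Pb: "prob_space Pb" "sets Pb = sets (prodX M)" "finite_moment (costM c M) Pb"
    and \<pi>: "\<pi> \<in> couplings Pb (PiM {..<M} (\<lambda>_. Phat))" and R: "symmetrization x0 M \<pi> R"
    and a: "ereal a < expect Pb (symz M (loss \<circ> proj N))"
  shows "integrable R (\<lambda>z. loss (proj N (fst \<circ> z)))" "a < (\<integral>z. loss (proj N (fst \<circ> z)) \<partial>R)"
proof -
  have sR: "sets R = sets borel"
    and int: "\<And>f. f \<in> borel_measurable borel \<Longrightarrow>
      (\<integral>\<^sup>+ z. f z \<partial>R) = (\<Sum>\<sigma>\<in>perms M. \<integral>\<^sup>+ w. f (spread x0 M \<sigma> w) \<partial>\<pi>) / ennreal (real (card (perms M)))"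
    using R unfolding symmetrization_def by auto
  have s\<pi>: "sets \<pi> = sets (prodX M \<Otimes>\<^sub>M prodX M)"
    using \<pi> Pb(2) sets_PiM_Phat[of M] sets_pair_measure_cong[of Pb "prodX M"] by (auto simp: couplings_def)
  have fst\<pi>: "distr \<pi> Pb fst = Pb"
    using \<pi> by (simp add: couplings_def)
  have fstm: "fst \<in> measurable \<pi> Pb"
    using measurable_cong_sets[OF s\<pi> Pb(2)] measurable_fst[of "prodX M" "prodX M"] by blast
  have gm: "(\<lambda>x. loss (proj N (x \<circ> \<sigma>))) \<in> borel_measurable Pb" if "\<sigma> permutes {..<M}" for \<sigma>
    using loss_measurable_prodX[OF M that] measurable_cong_sets[OF Pb(2) refl] by blast
  have symz_eq: "symz M (loss \<circ> proj N) = (\<lambda>x. (\<Sum>\<sigma>\<in>perms M. loss (proj N (x \<circ> \<sigma>))) / fact M)"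
    by (simp add: symz_def fun_eq_iff)
  have avg: "\<And>\<sigma>. \<sigma> \<in> perms M \<Longrightarrow> integrable Pb (\<lambda>x. loss (proj N (x \<circ> \<sigma>)))"
    "a < (\<Sum>\<sigma>\<in>perms M. \<integral>x. loss (proj N (x \<circ> \<sigma>)) \<partial>Pb) / fact M"
    using expect_average_gt[of "perms M" "\<lambda>\<sigma> x. loss (proj N (x \<circ> \<sigma>))" Pb "fact M" a] perms_finite gm
      loss_positive_part_finite[OF Pb M] a[unfolded symz_eq] by auto
  have f_spread: "proj N (fst \<circ> spread x0 M \<sigma> w) = proj N (fst w \<circ> \<sigma>)" for \<sigma> w
    using M by (auto simp: proj_def spread_def fun_eq_iff restrict_def)
  have fm: "(\<lambda>z :: nat \<Rightarrow> 'a \<times> 'a. loss (proj N (fst \<circ> z))) \<in> borel_measurable borel"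
  proof (rule measurable_compose[OF _ loss_measurable])
    show "(\<lambda>z :: nat \<Rightarrow> 'a \<times> 'a. fst \<circ> z) \<in> borel_measurable borel"
      by (intro borel_measurable_continuous_onI continuous_on_coordinatewise_then_product)
         (simp add: comp_def continuous_on_fst)
  qed
  have \<pi>int: "integrable \<pi> (\<lambda>w. loss (proj N (fst \<circ> spread x0 M \<sigma> w)))"
    "(\<integral>w. loss (proj N (fst \<circ> spread x0 M \<sigma> w)) \<partial>\<pi>) = (\<integral>x. loss (proj N (x \<circ> \<sigma>)) \<partial>Pb)"
    if \<sigma>: "\<sigma> \<in> perms M" for \<sigma>
  proof -
    have m: "(\<lambda>x. loss (proj N (x \<circ> \<sigma>))) \<in> borel_measurable Pb"
      using gm \<sigma> by simp
    show "integrable \<pi> (\<lambda>w. loss (proj N (fst \<circ> spread x0 M \<sigma> w)))"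
      unfolding f_spread using avg(1)[OF \<sigma>] integrable_distr_eq[OF fstm m] fst\<pi> by simp
    show "(\<integral>w. loss (proj N (fst \<circ> spread x0 M \<sigma> w)) \<partial>\<pi>) = (\<integral>x. loss (proj N (x \<circ> \<sigma>)) \<partial>Pb)"
      unfolding f_spread using integral_distr[OF fstm m] fst\<pi> by simp
  qed
  note mix = mixture_integral[where T = "spread x0 M" and M = \<pi> and N = borel and
      f = "\<lambda>z. loss (proj N (fst \<circ> z))", OF perms_finite perms_nonempty sR int fm \<pi>int(1)]
  show "integrable R (\<lambda>z. loss (proj N (fst \<circ> z)))"
    by (rule mix(1))
  show "a < (\<integral>z. loss (proj N (fst \<circ> z)) \<partial>R)"
    using mix(2) avg(2) \<pi>int(2) by (simp add: card_perms)
qed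

lemma comp_measurable:
  "(\<lambda>z :: nat \<Rightarrow> 'a \<times> 'a. fst \<circ> z) \<in> borel_measurable borel"
  "(\<lambda>z :: nat \<Rightarrow> 'a \<times> 'a. snd \<circ> z) \<in> borel_measurable borel"
  by (intro borel_measurable_continuous_onI continuous_on_coordinatewise_then_product;
      simp add: comp_def continuous_on_fst continuous_on_snd)+

lemma proj_measurable_borel:
  "proj K \<in> measurable (borel :: (nat \<Rightarrow> 'a) measure) (prodX K)"
  unfolding proj_def
  by (intro measurable_restrict borel_measurable_continuous_onI continuous_on_product_coordinates)

lemma cost_coordinates_lsc:
  "lsc (\<lambda>z :: nat \<Rightarrow> 'a \<times> 'a. c (fst (z i)) (snd (z i)))"
  "lsc (\<lambda>z :: nat \<Rightarrow> 'a \<times> 'a. c y (fst (z i)))"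
  "lsc (\<lambda>z :: nat \<Rightarrow> 'a \<times> 'a. c y (snd (z i)))"
  by (intro proper_cost_lsc[OF cost] continuous_intros; simp)+

text \<open>These are the properties that the limit argument consumes. Exchangeability and the
  product marginal hold up to \<open>M\<close>, hence eventually for each fixed \<open>K\<close>;
  the moment bound \<open>B\<close> is independent of \<open>M\<close> and includes the padded
  coordinates.\<close>

definition approximant :: "'a \<Rightarrow> real \<Rightarrow> real \<Rightarrow> nat \<Rightarrow> (nat \<Rightarrow> 'a \<times> 'a) measure \<Rightarrow> bool" where
  "approximant x0 B a M R \<longleftrightarrow> prob_space R \<and> sets R = sets borel \<and>
    (\<forall>K\<le>M. \<forall>\<tau>. \<tau> permutes {..<K} \<longrightarrow> distr R borel (\<lambda>z. z \<circ> \<tau>) = R) \<and>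
    (\<forall>K\<le>M. distr R borel (\<lambda>z i. if i < K then snd (z i) else x0) = distr (PiM {..<K} (\<lambda>_. Phat)) borel (pad x0 K)) \<and>
    (\<forall>i<M. (\<integral>\<^sup>+ z. ennreal (c (fst (z i)) (snd (z i))) \<partial>R) \<le> ennreal (\<rho> + 1 / real M)) \<and>
    (\<forall>i. (\<integral>\<^sup>+ z. ennreal (c x0 (fst (z i))) \<partial>R) \<le> ennreal B) \<and>
    (\<forall>i. (\<integral>\<^sup>+ z. ennreal (c x0 (snd (z i))) \<partial>R) \<le> ennreal B) \<and>
    integrable R (\<lambda>z. loss (proj N (fst \<circ> z))) \<and> a < (\<integral>z. loss (proj N (fst \<circ> z)) \<partial>R)"

text \<open>All bounds come from one almost optimal coupling. The first block inherits its moments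
  from the second and from the coupling cost, with a constant free of \<open>M\<close> because
  \<open>1 / real M \<le> 1\<close>.\<close>

lemma wball_symmetrization:
  assumes M: "N \<le> M" and Pb: "Pb \<in> wball c Phat \<rho> M"
    and a: "ereal a < expect Pb (symz M (loss \<circ> proj N))"
    and C: "C \<ge> 1" "\<And>x y z. c x z \<le> C * (c x y + c y z)"
    and m: "(\<integral>\<^sup>+ x. ennreal (c x0 x) \<partial>Phat) = ennreal m" "0 \<le> m"
  shows "\<exists>R. approximant x0 (C * (m + \<rho> + 1)) a M R"
proof -
  have M0: "0 < M"
    using M N by simp
  have pb: "prob_space Pb" "sets Pb = sets (prodX M)" "finite_moment (costM c M) Pb"
    and OT: "OT (costM c M) Pb (PiM {..<M} (\<lambda>_. Phat)) \<le> ennreal (real M * \<rho>)"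
    using Pb by (auto simp: wball_def)
  note OT
  \<comment> \<open>Strict slack yields a coupling without attainment of the infimum; shared among
    \<open>M\<close> coordinates, the slack 1 becomes the term \<open>1 / real M\<close>.\<close>
  also have "ennreal (real M * \<rho>) < ennreal (real M * \<rho> + 1)"
    using rho by (intro ennreal_lessI) (auto simp: add_nonneg_pos)
  finally obtain \<pi> where \<pi>: "\<pi> \<in> couplings Pb (PiM {..<M} (\<lambda>_. Phat))"
    and cost\<pi>: "(\<integral>\<^sup>+ w. ennreal (costM c M (fst w) (snd w)) \<partial>\<pi>) < ennreal (real M * \<rho> + 1)"
    unfolding OT_def INF_less_iff by auto
  have \<pi>p: "prob_space \<pi>" and s\<pi>: "sets \<pi> = sets (prodX M \<Otimes>\<^sub>M prodX M)"
    using \<pi> pb(2) sets_PiM_Phat[of M] sets_pair_measure_cong[of Pb "prodX M"] by (auto simp: couplings_def)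
  obtain R where R: "symmetrization x0 M \<pi> R"
    using symmetrization_exists[OF \<pi>p s\<pi>] by blast
  have pR: "prob_space R" and sR: "sets R = sets borel"
    using R by (auto simp: symmetrization_def)
  have cost_R: "(\<integral>\<^sup>+ z. ennreal (c (fst (z i)) (snd (z i))) \<partial>R) \<le> ennreal (\<rho> + 1 / real M)" if "i < M" for i
    using symmetrization_cost[OF cost R s\<pi> less_imp_le[OF cost\<pi>] that] M0 by (simp add: add_divide_distrib)
  have cx0: "(\<lambda>x. ennreal (c x0 x)) \<in> borel_measurable borel"
    by (intro measurable_compose[OF _ measurable_ennreal] proper_cost_measurable[OF cost]) auto
  have snd_R: "(\<integral>\<^sup>+ z. ennreal (c x0 (snd (z i))) \<partial>R) \<le> ennreal m" for i
  proof (cases "i < M")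
    case True
    then show ?thesis
      using symmetrization_snd_integral[OF R \<pi> pb(2) Phat(1,2) cx0 True] m by simp
  next
    case False
    have "(\<lambda>p :: 'a \<times> 'a. ennreal (c x0 (snd p))) \<in> borel_measurable borel"
      by (intro measurable_compose[OF _ cx0] borel_measurable_continuous_onI continuous_intros)
    then show ?thesis
      using symmetrization_padding[OF R, of "\<lambda>p. ennreal (c x0 (snd p))" i] False by (simp add: cost_refl)
  qed
  have meas: "(\<lambda>z. c (fst (z i)) (snd (z i))) \<in> borel_measurable R" "(\<lambda>z. c x0 (snd (z i))) \<in> borel_measurable R" for i
    using lsc_borel_measurable[OF cost_coordinates_lsc(1)] lsc_borel_measurable[OF cost_coordinates_lsc(3)]
      measurable_cong_sets[OF sR refl] by blast+
  have fst_R: "(\<integral>\<^sup>+ z. ennreal (c x0 (fst (z i))) \<partial>R) \<le> ennreal (C * (m + \<rho> + 1))" for i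
  proof (cases "i < M")
    case True
    have "(\<integral>\<^sup>+ z. ennreal (c x0 (fst (z i))) \<partial>R)
      \<le> (\<integral>\<^sup>+ z. ennreal C * (ennreal (c x0 (snd (z i))) + ennreal (c (fst (z i)) (snd (z i)))) \<partial>R)"
    proof (rule nn_integral_mono)
      fix z :: "nat \<Rightarrow> 'a \<times> 'a"
      have "ennreal (c x0 (fst (z i))) \<le> ennreal (C * (c x0 (snd (z i)) + c (fst (z i)) (snd (z i))))"
        using C(2)[of x0 "fst (z i)" "snd (z i)"] cost_sym[of "fst (z i)"] by (intro ennreal_leI) simp
      then show "ennreal (c x0 (fst (z i))) \<le> ennreal C * (ennreal (c x0 (snd (z i))) + ennreal (c (fst (z i)) (snd (z i))))"
        using C(1) cost_nonneg by (simp add: ennreal_mult ennreal_plus)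
    qed
    also have "\<dots> = ennreal C * ((\<integral>\<^sup>+ z. ennreal (c x0 (snd (z i))) \<partial>R) + (\<integral>\<^sup>+ z. ennreal (c (fst (z i)) (snd (z i))) \<partial>R))"
      using meas[of i] by (simp add: nn_integral_cmult nn_integral_add)
    also have "\<dots> \<le> ennreal C * (ennreal m + ennreal (\<rho> + 1 / real M))"
      by (intro mult_left_mono add_mono snd_R cost_R True) simp
    also have "\<dots> = ennreal (C * (m + (\<rho> + 1 / real M)))"
      using C(1) m(2) rho by (simp add: ennreal_mult ennreal_plus)
    also have "\<dots> \<le> ennreal (C * (m + \<rho> + 1))"
    proof -
      have "1 / real M \<le> 1"
        using M0 by simp
      then show ?thesis
        using C(1) by (intro ennreal_leI mult_left_mono) linarith+
    qed
    finally show ?thesis .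
  next
    case False
    have "(\<lambda>p :: 'a \<times> 'a. ennreal (c x0 (fst p))) \<in> borel_measurable borel"
      by (intro measurable_compose[OF _ cx0] borel_measurable_continuous_onI continuous_intros)
    then show ?thesis
      using symmetrization_padding[OF R, of "\<lambda>p. ennreal (c x0 (fst p))" i] False by (simp add: cost_refl)
  qed
  have "m \<le> C * (m + \<rho> + 1)"
  proof -
    have "m \<le> 1 * (m + \<rho> + 1)"
      using rho by simp
    also have "\<dots> \<le> C * (m + \<rho> + 1)"
      using C(1) m(2) rho by (intro mult_right_mono) auto
    finally show ?thesis .
  qed
  then have snd_R': "(\<integral>\<^sup>+ z. ennreal (c x0 (snd (z i))) \<partial>R) \<le> ennreal (C * (m + \<rho> + 1))" for i
    using snd_R[of i] ennreal_leI order_trans by blast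
  show ?thesis
    unfolding approximant_def using pR sR cost_R fst_R snd_R' symmetrization_perm_invariant[OF R]
      symmetrization_snd_marginal[OF R \<pi> pb(2) Phat(1,2)] symmetrization_loss[OF M pb \<pi> R a]
    by (intro exI[of _ R] conjI allI impI) blast+
qed

text \<open>The joint law of the first \<open>K\<close> pairs is itself a coupling with the product
  of \<open>Phat\<close>, and its cost is a sum of \<open>K\<close> terms of size at most
  \<rho>.\<close>

lemma marginal_in_wball_sym:
  assumes R: "prob_space R" "sets R = sets borel"
    and perm: "\<And>\<tau>. \<tau> permutes {..<K} \<Longrightarrow> distr R borel (\<lambda>z. z \<circ> \<tau>) = R"
    and sndR: "distr R borel (\<lambda>z i. if i < K then snd (z i) else x0) = distr (PiM {..<K} (\<lambda>_. Phat)) borel (pad x0 K)"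
    and costR: "\<And>i. (\<integral>\<^sup>+ z. ennreal (c (fst (z i)) (snd (z i))) \<partial>R) \<le> ennreal \<rho>"
    and fstR: "\<And>i. (\<integral>\<^sup>+ z. ennreal (c x0 (fst (z i))) \<partial>R) \<le> ennreal B"
  shows "distr R (prodX K) (\<lambda>z. proj K (fst \<circ> z)) \<in> wball_sym c Phat \<rho> K"
proof -
  have mR: "f \<in> measurable R A" if "f \<in> measurable borel A" for f and A :: "'c measure"
    using that measurable_cong_sets[OF R(2) refl] by blast
  have fm: "(\<lambda>z :: nat \<Rightarrow> 'a \<times> 'a. proj K (fst \<circ> z)) \<in> measurable borel (prodX K :: (nat \<Rightarrow> 'a) measure)"
    and sm: "(\<lambda>z :: nat \<Rightarrow> 'a \<times> 'a. proj K (snd \<circ> z)) \<in> measurable borel (prodX K :: (nat \<Rightarrow> 'a) measure)"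
    using measurable_compose[OF comp_measurable(1) proj_measurable_borel]
      measurable_compose[OF comp_measurable(2) proj_measurable_borel] by auto
  let ?P = "PiM {..<K} (\<lambda>_. Phat)"
  let ?Q = "distr R (prodX K) (\<lambda>z. proj K (fst \<circ> z))"
  have pQ: "prob_space ?Q"
    by (rule prob_space.prob_space_distr[OF R(1) mR[OF fm]])
  have cm: "(\<lambda>z :: nat \<Rightarrow> 'a \<times> 'a. ennreal (c (fst (z i)) (snd (z i)))) \<in> borel_measurable borel"
    "(\<lambda>z :: nat \<Rightarrow> 'a \<times> 'a. ennreal (c y (fst (z i)))) \<in> borel_measurable borel" for i y
    using lsc_borel_measurable[OF cost_coordinates_lsc(1)] lsc_borel_measurable[OF cost_coordinates_lsc(2)] by simp_all
  have costM_ennreal: "ennreal (costM c K x y) = (\<Sum>i<K. ennreal (c (x i) (y i)))" for x y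
    unfolding costM_def using cost_nonneg by (subst sum_ennreal) auto
  have fin: "finite_moment (costM c K) ?Q"
    unfolding finite_moment_def
  proof (rule bexI)
    show "proj K (\<lambda>_. x0) \<in> space ?Q"
      by (simp add: proj_def space_PiM)
    have "(\<lambda>x. costM c K (proj K (\<lambda>_. x0)) x) \<in> borel_measurable (prodX K)"
      unfolding costM_def
      by (intro borel_measurable_sum proper_cost_measurable[OF cost] measurable_prodX_component) auto
    then have "(\<integral>\<^sup>+ x. ennreal (costM c K (proj K (\<lambda>_. x0)) x) \<partial>?Q)
        = (\<integral>\<^sup>+ z. ennreal (costM c K (proj K (\<lambda>_. x0)) (proj K (fst \<circ> z))) \<partial>R)"
      using mR[OF fm] by (subst nn_integral_distr) auto
    also have "\<dots> = (\<integral>\<^sup>+ z. (\<Sum>i<K. ennreal (c x0 (fst (z i)))) \<partial>R)"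
      unfolding costM_ennreal by (intro nn_integral_cong sum.cong) (auto simp: proj_def)
    also have "\<dots> = (\<Sum>i<K. \<integral>\<^sup>+ z. ennreal (c x0 (fst (z i))) \<partial>R)"
      using mR[OF cm(2)] by (intro nn_integral_sum) auto
    also have "\<dots> < \<infinity>"
      using le_less_trans[OF fstR ennreal_less_top] by auto
    finally show "(\<integral>\<^sup>+ x. ennreal (costM c K (proj K (\<lambda>_. x0)) x) \<partial>?Q) < \<infinity>" .
  qed
  have snd_eq: "distr R (prodX K) (\<lambda>z. proj K (snd \<circ> z)) = ?P"
  proof -
    have Ym: "(\<lambda>z i. if i < K then snd (z i) else x0) \<in> measurable R borel"
    proof (rule mR, rule borel_measurable_continuous_onI, rule continuous_on_coordinatewise_then_product)
      show "continuous_on UNIV (\<lambda>z :: nat \<Rightarrow> 'a \<times> 'a. if i < K then snd (z i) else x0)" for i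
        by (cases "i < K") (auto intro!: continuous_intros)
    qed
    have padm: "pad x0 K \<in> measurable ?P borel"
      using pad_measurable measurable_cong_sets[OF sets_PiM_Phat refl] by blast
    have "distr R (prodX K) (\<lambda>z. proj K (snd \<circ> z)) = distr R (prodX K) (proj K \<circ> (\<lambda>z i. if i < K then snd (z i) else x0))"
      by (intro distr_cong) (auto simp: proj_def restrict_def fun_eq_iff)
    also have "\<dots> = distr (distr R borel (\<lambda>z i. if i < K then snd (z i) else x0)) (prodX K) (proj K)"
      by (rule distr_distr[symmetric, OF proj_measurable_borel Ym])
    also have "\<dots> = distr ?P (prodX K) (proj K \<circ> pad x0 K)"
      unfolding sndR by (rule distr_distr[OF proj_measurable_borel padm])
    \<comment> \<open>On extensional functions \<open>proj K\<close> undoes the padding.\<close>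
    also have "\<dots> = distr ?P ?P (\<lambda>x. x)"
      using sets_PiM_Phat[of K]
      by (intro distr_cong) (auto simp: proj_def pad_def restrict_def fun_eq_iff space_PiM PiE_iff extensional_def)
    also have "\<dots> = ?P"
      by (rule distr_id)
    finally show ?thesis .
  qed
  let ?pair = "\<lambda>z :: nat \<Rightarrow> 'a \<times> 'a. (proj K (fst \<circ> z), proj K (snd \<circ> z))"
  let ?\<pi> = "distr R (prodX K \<Otimes>\<^sub>M prodX K) ?pair"
  have pm: "?pair \<in> measurable R (prodX K \<Otimes>\<^sub>M prodX K)"
    by (intro measurable_Pair mR fm sm)
  have "?\<pi> \<in> couplings ?Q ?P"
  proof -
    have "sets ?\<pi> = sets (?Q \<Otimes>\<^sub>M ?P)"
      using sets_PiM_Phat[of K] by (simp cong: sets_pair_measure_cong)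
    moreover have "prob_space ?\<pi>"
      by (rule prob_space.prob_space_distr[OF R(1) pm])
    moreover have "distr ?\<pi> ?Q fst = ?Q"
    proof -
      have "distr ?\<pi> ?Q fst = distr ?\<pi> (prodX K) fst"
        by (intro distr_cong) auto
      also have "\<dots> = distr R (prodX K) (fst \<circ> ?pair)"
        by (rule distr_distr[OF measurable_fst pm])
      finally show ?thesis by (simp add: comp_def)
    qed
    moreover have "distr ?\<pi> ?P snd = ?P"
    proof -
      have "distr ?\<pi> ?P snd = distr ?\<pi> (prodX K) snd"
        using sets_PiM_Phat[of K] by (intro distr_cong) auto
      also have "\<dots> = distr R (prodX K) (snd \<circ> ?pair)"
        by (rule distr_distr[OF measurable_snd pm])
      also have "\<dots> = ?P"
        using snd_eq by (simp add: comp_def)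
      finally show ?thesis .
    qed
    ultimately show ?thesis
      by (simp add: couplings_def)
  qed
  then have "OT (costM c K) ?Q ?P \<le> (\<integral>\<^sup>+ w. ennreal (costM c K (fst w) (snd w)) \<partial>?\<pi>)"
    unfolding OT_def by (rule INF_lower)
  also have "\<dots> = (\<integral>\<^sup>+ z. ennreal (costM c K (proj K (fst \<circ> z)) (proj K (snd \<circ> z))) \<partial>R)"
  proof -
    have "(\<lambda>w. costM c K (fst w) (snd w)) \<in> borel_measurable (prodX K \<Otimes>\<^sub>M prodX K)"
      unfolding costM_def
      by (intro borel_measurable_sum proper_cost_measurable[OF cost]
           measurable_compose[OF measurable_fst measurable_prodX_component]
           measurable_compose[OF measurable_snd measurable_prodX_component]) auto
    then show ?thesis
      using pm by (subst nn_integral_distr) auto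
  qed
  also have "\<dots> = (\<integral>\<^sup>+ z. (\<Sum>i<K. ennreal (c (fst (z i)) (snd (z i)))) \<partial>R)"
    unfolding costM_ennreal by (intro nn_integral_cong sum.cong) (auto simp: proj_def)
  also have "\<dots> = (\<Sum>i<K. \<integral>\<^sup>+ z. ennreal (c (fst (z i)) (snd (z i))) \<partial>R)"
    using mR[OF cm(1)] by (intro nn_integral_sum) auto
  also have "\<dots> \<le> (\<Sum>i<K. ennreal \<rho>)"
    by (intro sum_mono costR)
  also have "\<dots> = ennreal (real K * \<rho>)"
    using rho by (simp add: ennreal_mult ennreal_of_nat_eq_real_of_nat)
  finally have OT: "OT (costM c K) ?Q ?P \<le> ennreal (real K * \<rho>)" .
  have "perm_invariant K ?Q"
    unfolding perm_invariant_def
  proof (intro allI impI)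
    fix \<sigma> assume \<sigma>: "\<sigma> permutes {..<K}"
    have \<sigma>m: "(\<lambda>z :: nat \<Rightarrow> 'a \<times> 'a. z \<circ> \<sigma>) \<in> measurable R borel"
      by (intro mR borel_measurable_continuous_onI continuous_on_reindex)
    have "distr ?Q (prodX K) (\<lambda>x. x \<circ> \<sigma>) = distr R (prodX K) ((\<lambda>x. x \<circ> \<sigma>) \<circ> (\<lambda>z. proj K (fst \<circ> z)))"
      by (rule distr_distr[OF permute_measurable[OF \<sigma>] mR[OF fm]])
    also have "\<dots> = distr R (prodX K) ((\<lambda>z. proj K (fst \<circ> z)) \<circ> (\<lambda>z. z \<circ> \<sigma>))"
      using permutes_in_image[OF \<sigma>] by (intro distr_cong) (auto simp: proj_def fun_eq_iff restrict_def)
    also have "\<dots> = distr (distr R borel (\<lambda>z. z \<circ> \<sigma>)) (prodX K) (\<lambda>z. proj K (fst \<circ> z))"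
      by (rule distr_distr[symmetric, OF fm \<sigma>m])
    also have "\<dots> = ?Q"
      unfolding perm[OF \<sigma>] ..
    finally show "distr ?Q (prodX K) (\<lambda>x. x \<circ> \<sigma>) = ?Q" .
  qed
  with pQ fin OT show ?thesis
    by (simp add: wball_sym_def wball_def)
qed


section \<open>The loss in the limit\<close>

text \<open>Changes the reference point from \<open>x0\<close>, where the moments are controlled, to
  \<open>xh\<close>, where the growth of the loss is measured. The bound depends on \<open>R\<close>
  only through \<open>B\<close>.\<close>

lemma growth_cost_bound:
  fixes C :: real and xh :: "nat \<Rightarrow> 'a" and R :: "(nat \<Rightarrow> 'a \<times> 'a) measure"
  assumes C: "C \<ge> 1" "\<And>x y z. c x z \<le> C * (c x y + c y z)"
    and R: "prob_space R" "sets R = sets borel"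
    and fstR: "\<And>i. (\<integral>\<^sup>+ z. ennreal (c x0 (fst (z i))) \<partial>R) \<le> ennreal B" and B: "0 \<le> B"
  shows "integrable R (\<lambda>z. costM c N xh (fst \<circ> z))"
    "(\<integral>z. costM c N xh (fst \<circ> z) \<partial>R) \<le> (\<Sum>i<N. C * (c (xh i) x0 + B))"
proof -
  interpret prob_space R by (rule R(1))
  have meas: "(\<lambda>z. c y (fst (z i))) \<in> borel_measurable R" for i y
    using lsc_borel_measurable[OF cost_coordinates_lsc(2)] measurable_cong_sets[OF R(2) refl] by blast
  have single: "(\<integral>\<^sup>+ z. ennreal (c (xh i) (fst (z i))) \<partial>R) \<le> ennreal (C * (c (xh i) x0 + B))" for i
  proof -
    have "(\<integral>\<^sup>+ z. ennreal (c (xh i) (fst (z i))) \<partial>R)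
        \<le> (\<integral>\<^sup>+ z. ennreal C * (ennreal (c (xh i) x0) + ennreal (c x0 (fst (z i)))) \<partial>R)"
    proof (rule nn_integral_mono)
      fix z :: "nat \<Rightarrow> 'a \<times> 'a"
      have "ennreal (c (xh i) (fst (z i))) \<le> ennreal (C * (c (xh i) x0 + c x0 (fst (z i))))"
        by (intro ennreal_leI C)
      then show "ennreal (c (xh i) (fst (z i))) \<le> ennreal C * (ennreal (c (xh i) x0) + ennreal (c x0 (fst (z i))))"
        using C(1) cost_nonneg by (simp add: ennreal_mult ennreal_plus)
    qed
    also have "\<dots> = ennreal C * (ennreal (c (xh i) x0) + (\<integral>\<^sup>+ z. ennreal (c x0 (fst (z i))) \<partial>R))"
      using meas by (simp add: nn_integral_cmult nn_integral_add emeasure_space_1)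
    also have "\<dots> \<le> ennreal C * (ennreal (c (xh i) x0) + ennreal B)"
      by (intro mult_left_mono add_left_mono fstR) simp
    also have "\<dots> = ennreal (C * (c (xh i) x0 + B))"
      using C(1) cost_nonneg B by (simp add: ennreal_mult ennreal_plus)
    finally show ?thesis .
  qed
  have "(\<integral>\<^sup>+ z. ennreal (costM c N xh (fst \<circ> z)) \<partial>R) = (\<integral>\<^sup>+ z. (\<Sum>i<N. ennreal (c (xh i) (fst (z i)))) \<partial>R)"
    unfolding costM_def using cost_nonneg by (subst sum_ennreal) auto
  also have "\<dots> = (\<Sum>i<N. \<integral>\<^sup>+ z. ennreal (c (xh i) (fst (z i))) \<partial>R)"
    using meas by (intro nn_integral_sum) auto
  also have "\<dots> \<le> (\<Sum>i<N. ennreal (C * (c (xh i) x0 + B)))"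
    by (intro sum_mono single)
  also have "\<dots> = ennreal (\<Sum>i<N. C * (c (xh i) x0 + B))"
    using C(1) cost_nonneg B by (intro sum_ennreal) auto
  finally have le: "(\<integral>\<^sup>+ z. ennreal (costM c N xh (fst \<circ> z)) \<partial>R) \<le> ennreal (\<Sum>i<N. C * (c (xh i) x0 + B))" .
  have m: "(\<lambda>z. costM c N xh (fst \<circ> z)) \<in> borel_measurable R"
    unfolding costM_def comp_def by (intro borel_measurable_sum meas)
  show int: "integrable R (\<lambda>z. costM c N xh (fst \<circ> z))"
    using m le costM_nonneg le_less_trans[OF le ennreal_less_top]
    by (intro integrableI_nonneg) auto
  have "ennreal (\<integral>z. costM c N xh (fst \<circ> z) \<partial>R) \<le> ennreal (\<Sum>i<N. C * (c (xh i) x0 + B))"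
    using le nn_integral_eq_integral[OF int] costM_nonneg by simp
  moreover have "0 \<le> (\<Sum>i<N. C * (c (xh i) x0 + B))"
    using C(1) cost_nonneg B by (intro sum_nonneg) auto
  ultimately show "(\<integral>z. costM c N xh (fst \<circ> z) \<partial>R) \<le> (\<Sum>i<N. C * (c (xh i) x0 + B))"
    by (simp add: ennreal_le_iff)
qed

text \<open>For fixed \<epsilon> the limit loses at most \<open>\<epsilon> * B2\<close>: the
  constant \<open>D\<close>, which depends on \<epsilon>, cancels between the bound on the integrals
  of \<open>g\<close> and the recovery of the loss from \<open>g\<close>.\<close>

lemma limit_measure_loss:
  fixes Q :: "nat \<Rightarrow> (nat \<Rightarrow> 'a \<times> 'a) measure"
  assumes lim: "limit_measure F Q R" and Q: "\<And>n. prob_space (Q n)" "\<And>n. sets (Q n) = sets borel"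
    and B: "0 \<le> B" "\<And>n i. (\<integral>\<^sup>+ z. ennreal (c x0 (fst (z i))) \<partial>Q n) \<le> ennreal B"
      "\<And>i. (\<integral>\<^sup>+ z. ennreal (c x0 (fst (z i))) \<partial>R) \<le> ennreal B"
    and int: "\<And>n. integrable (Q n) (\<lambda>z. loss (proj N (fst \<circ> z)))"
    and a: "\<And>n. a < (\<integral>z. loss (proj N (fst \<circ> z)) \<partial>Q n)"
  shows "integrable R (\<lambda>z. loss (proj N (fst \<circ> z)))" "a \<le> (\<integral>z. loss (proj N (fst \<circ> z)) \<partial>R)"
proof -
  have R: "prob_space R" "sets R = sets borel"
    using lim by (auto simp: limit_measure_def)
  interpret R: prob_space R by fact
  obtain C where C: "C \<ge> 1" "\<And>x y z. c x z \<le> C * (c x y + c y z)"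
    using triangle by blast
  obtain xh where xh: "\<And>\<epsilon>. 0 < \<epsilon> \<Longrightarrow> \<exists>D\<ge>0. \<forall>x. loss (proj N x) \<le> D + \<epsilon> * costM c N xh x"
    using loss_growth by blast
  define B2 where "B2 = (\<Sum>i<N. C * (c (xh i) x0 + B))"
  have "0 \<le> B2"
    unfolding B2_def using C(1) cost_nonneg B by (intro sum_nonneg) auto
  have intcR: "integrable R (\<lambda>z. costM c N xh (fst \<circ> z))"
    using growth_cost_bound(1)[OF C R B(3) B(1)] .
  have main: "integrable R (\<lambda>z. loss (proj N (fst \<circ> z))) \<and> a - \<epsilon> * B2 \<le> (\<integral>z. loss (proj N (fst \<circ> z)) \<partial>R)"
    if \<epsilon>: "0 < \<epsilon>" for \<epsilon>
  proof -
    obtain D where D: "0 \<le> D" "\<And>x. loss (proj N x) \<le> D + \<epsilon> * costM c N xh x"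
      using xh[OF \<epsilon>] by blast
    define g where "g z = (D + \<epsilon> * costM c N xh (fst \<circ> z)) + - loss (proj N (fst \<circ> z))" for z :: "nat \<Rightarrow> 'a \<times> 'a"
    have g0: "0 \<le> g z" for z
      using D(2)[of "fst \<circ> z"] by (simp add: g_def)
    have g_lsc: "lsc g"
      unfolding g_def
    proof (intro lsc_add lsc_const lsc_cmult)
      show "lsc (\<lambda>z :: nat \<Rightarrow> 'a \<times> 'a. costM c N xh (fst \<circ> z))"
        unfolding costM_def comp_def by (intro lsc_sum cost_coordinates_lsc)
      show "lsc (\<lambda>z :: nat \<Rightarrow> 'a \<times> 'a. - loss (proj N (fst \<circ> z)))"
        by (rule lsc_compose[OF loss_lsc])
           (intro continuous_on_coordinatewise_then_product, simp add: comp_def continuous_on_fst)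
    qed (use \<epsilon> in auto)
    \<comment> \<open>Bounds every integral of \<open>g\<close> under \<open>Q n\<close>: the loss
      integrates to more than \<open>a\<close>, the cost to at most \<open>B2\<close>.\<close>
    define t where "t = D + \<epsilon> * B2 - a"
    have Qg: "integrable (Q n) g \<and> (\<integral>z. g z \<partial>Q n) \<le> t" for n
    proof -
      interpret Qn: prob_space "Q n" by (rule Q)
      have ic: "integrable (Q n) (\<lambda>z. costM c N xh (fst \<circ> z))"
        and le: "(\<integral>z. costM c N xh (fst \<circ> z) \<partial>Q n) \<le> B2"
        using growth_cost_bound[OF C Q B(2) B(1)] by (auto simp: B2_def)
      have "(\<integral>z. g z \<partial>Q n) = D + \<epsilon> * (\<integral>z. costM c N xh (fst \<circ> z) \<partial>Q n) - (\<integral>z. loss (proj N (fst \<circ> z)) \<partial>Q n)"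
        unfolding g_def using ic int[of n] by (simp add: Qn.prob_space)
      moreover have "\<epsilon> * (\<integral>z. costM c N xh (fst \<circ> z) \<partial>Q n) \<le> \<epsilon> * B2"
        using le \<epsilon> by (intro mult_left_mono) auto
      moreover have "integrable (Q n) g"
        unfolding g_def using ic int[of n] by auto
      ultimately show ?thesis
        using a[of n] unfolding t_def by linarith
    qed
    \<comment> \<open>A negative \<open>t\<close> would be truncated by \<open>ennreal\<close>, so
      its sign is settled first.\<close>
    have "0 \<le> (\<integral>z. g z \<partial>Q 0)"
      using g0 by (intro integral_nonneg_AE) auto
    then have t0: "0 \<le> t"
      using Qg[of 0] by linarith
    have gR: "(\<integral>\<^sup>+ z. ennreal (g z) \<partial>R) \<le> ennreal t"
    proof (rule limit_measure_nn_integral_le[OF lim Q g_lsc g0])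
      show "\<forall>\<^sub>F n in F. (\<integral>\<^sup>+ z. ennreal (g z) \<partial>Q n) \<le> ennreal t"
        using Qg g0 by (intro always_eventually allI) (simp add: nn_integral_eq_integral ennreal_leI)
    qed simp
    have gm: "g \<in> borel_measurable R"
      using lsc_borel_measurable[OF g_lsc] measurable_cong_sets[OF R(2) refl] by blast
    have gi: "integrable R g"
      using gm g0 le_less_trans[OF gR ennreal_less_top] by (intro integrableI_nonneg) auto
    have "ennreal (\<integral>z. g z \<partial>R) \<le> ennreal t"
      using gR nn_integral_eq_integral[OF gi] g0 by simp
    then have gt: "(\<integral>z. g z \<partial>R) \<le> t"
      using t0 by (simp add: ennreal_le_iff)
    have loss_eq: "(\<lambda>z. loss (proj N (fst \<circ> z))) = (\<lambda>z. (D + \<epsilon> * costM c N xh (fst \<circ> z)) - g z)"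
      by (simp add: g_def)
    have "(\<integral>z. loss (proj N (fst \<circ> z)) \<partial>R) = D + \<epsilon> * (\<integral>z. costM c N xh (fst \<circ> z) \<partial>R) - (\<integral>z. g z \<partial>R)"
      unfolding loss_eq using intcR gi by (simp add: R.prob_space)
    moreover have "0 \<le> \<epsilon> * (\<integral>z. costM c N xh (fst \<circ> z) \<partial>R)"
      using \<epsilon> costM_nonneg by (intro mult_nonneg_nonneg integral_nonneg_AE) auto
    moreover have "integrable R (\<lambda>z. loss (proj N (fst \<circ> z)))"
      unfolding loss_eq using intcR gi by auto
    ultimately show ?thesis
      using gt unfolding t_def by linarith
  qed
  show "integrable R (\<lambda>z. loss (proj N (fst \<circ> z)))"
    using main[of 1] by simp
  show "a \<le> (\<integral>z. loss (proj N (fst \<circ> z)) \<partial>R)"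
  proof (rule field_le_epsilon)
    fix e :: real assume "0 < e"
    \<comment> \<open>Adding 1 keeps the denominator positive when \<open>B2 = 0\<close>.\<close>
    then have "0 < e / (B2 + 1)" "e / (B2 + 1) * B2 \<le> e"
      using \<open>0 \<le> B2\<close> by (auto simp: field_simps)
    with main[of "e / (B2 + 1)"] show "a \<le> (\<integral>z. loss (proj N (fst \<circ> z)) \<partial>R) + e"
      by linarith
  qed
qed

section \<open>The limit law and the duality\<close>

text \<open>A real \<open>a\<close> strictly below every supremum provides competitors with
  expectation above \<open>a\<close>, for which the loss is integrable after symmetrization. The
  weak inequality in the conclusion is what survives the limit.\<close>

lemma Uinf_attains_above:
  assumes a: "\<And>M. N \<le> M \<Longrightarrow> ereal a < Usym c Phat \<rho> N M loss"
  shows "\<exists>P\<in>Uinf c Phat \<rho> N. ereal a \<le> expect P loss"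
proof -
  obtain C where C: "C \<ge> 1" "\<And>x y z. c x z \<le> C * (c x y + c y z)"
    using triangle by blast
  obtain x0 where "(\<integral>\<^sup>+ x. ennreal (c x0 x) \<partial>Phat) < \<infinity>"
    using Phat(3) by (auto simp: finite_moment_def)
  then obtain m where m: "(\<integral>\<^sup>+ x. ennreal (c x0 x) \<partial>Phat) = ennreal m" "0 \<le> m"
    by (auto simp: less_top_ennreal)
  define B where "B = C * (m + \<rho> + 1)"
  have B: "0 < B"
    unfolding B_def using C(1) m(2) rho by (intro mult_pos_pos) auto
  \<comment> \<open>The shift by \<open>N\<close> makes the dimension run through all
    \<open>M \<ge> N\<close>.\<close>
  have "\<exists>R. approximant x0 B a (N + n) R" for n
  proof -
    obtain Pb where "Pb \<in> wball c Phat \<rho> (N + n)" "ereal a < expect Pb (symz (N + n) (loss \<circ> proj N))"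
      using a[of "N + n"] unfolding Usym_def less_SUP_iff by auto
    then show ?thesis
      unfolding B_def by (rule wball_symmetrization[OF le_add1 _ _ C m])
  qed
  then obtain Q where approx: "\<And>n. approximant x0 B a (N + n) (Q n)"
    by metis
  note Q_facts = approx[unfolded approximant_def]
  have Q1: "prob_space (Q n)" for n
    using Q_facts[of n] by (elim conjE)
  have Q2: "sets (Q n) = sets borel" for n
    using Q_facts[of n] by (elim conjE)
  note Q = Q1 Q2
  have permQ: "\<forall>K\<le>N + n. \<forall>\<tau>. \<tau> permutes {..<K} \<longrightarrow> distr (Q n) borel (\<lambda>z. z \<circ> \<tau>) = Q n" for n
    using Q_facts[of n] by (elim conjE)
  have sndQ: "\<forall>K\<le>N + n. distr (Q n) borel (\<lambda>z i. if i < K then snd (z i) else x0)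
      = distr (PiM {..<K} (\<lambda>_. Phat)) borel (pad x0 K)" for n
    using Q_facts[of n] by (elim conjE)
  have costQ: "\<forall>i<N + n. (\<integral>\<^sup>+ z. ennreal (c (fst (z i)) (snd (z i))) \<partial>Q n) \<le> ennreal (\<rho> + 1 / real (N + n))" for n
    using Q_facts[of n] by (elim conjE)
  have mom1: "(\<integral>\<^sup>+ z. ennreal (c x0 (fst (z i))) \<partial>Q n) \<le> ennreal B" for n i
    using Q_facts[of n] by (elim conjE) (erule spec)
  have mom2: "(\<integral>\<^sup>+ z. ennreal (c x0 (snd (z i))) \<partial>Q n) \<le> ennreal B" for n i
    using Q_facts[of n] by (elim conjE) (erule spec)
  have loss1: "integrable (Q n) (\<lambda>z. loss (proj N (fst \<circ> z)))" for n
    using Q_facts[of n] by (elim conjE)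
  have loss2: "a < (\<integral>z. loss (proj N (fst \<circ> z)) \<partial>Q n)" for n
    using Q_facts[of n] by (elim conjE)
  have "\<exists>F R. limit_measure F Q R \<and> F \<le> sequentially"
    by (rule tight_imp_limit_measure[OF Q moment_bound_imp_tight[OF cost Q B mom1 mom2]])
  then obtain F R where lim: "limit_measure F Q R" and F: "F \<le> sequentially"
    by blast
  have R: "prob_space R" "sets R = sets borel" "F \<noteq> bot"
    using lim by (auto simp: limit_measure_def)
  have evF: "\<forall>\<^sub>F n in F. K \<le> N + n" for K
    by (rule filter_leD[OF F]) (use eventually_ge_at_top[of K] in eventually_elim, simp)
  \<comment> \<open>The permuted laws eventually coincide with \<open>Q n\<close>, so the image of
    \<open>R\<close> is a second limit of \<open>Q\<close> and uniqueness identifies the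
    two.\<close>
  have permR: "distr R borel (\<lambda>z. z \<circ> \<tau>) = R" if \<tau>: "\<tau> permutes {..<K}" for \<tau> K
  proof -
    have "limit_measure F (\<lambda>n. distr (Q n) borel (\<lambda>z. z \<circ> \<tau>)) (distr R borel (\<lambda>z. z \<circ> \<tau>))"
      by (rule limit_measure_distr[OF lim Q(2) continuous_on_reindex])
    moreover have "\<forall>\<^sub>F n in F. distr (Q n) borel (\<lambda>z. z \<circ> \<tau>) = Q n"
      using evF[of K] by eventually_elim (rule permQ[rule_format, OF _ \<tau>])
    ultimately have "limit_measure F Q (distr R borel (\<lambda>z. z \<circ> \<tau>))"
      by (rule limit_measure_cong)
    then show ?thesis
      by (rule limit_measure_unique[OF _ lim Q])
  qed
  \<comment> \<open>The marginals of the approximants are eventually constant, and a constant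
    sequence has its value as the only limit.\<close>
  have sndR: "distr R borel (\<lambda>z i. if i < K then snd (z i) else x0) = distr (PiM {..<K} (\<lambda>_. Phat)) borel (pad x0 K)"
    (is "_ = ?\<nu>") for K
  proof -
    have padm: "pad x0 K \<in> measurable (PiM {..<K} (\<lambda>_. Phat)) borel"
      using pad_measurable measurable_cong_sets[OF sets_PiM_Phat refl] by blast
    have \<nu>: "prob_space ?\<nu>" "sets ?\<nu> = sets borel"
      using prob_space.prob_space_distr[OF prob_space_PiM padm] Phat(1) by auto
    have "continuous_on UNIV (\<lambda>(z :: nat \<Rightarrow> 'a \<times> 'a) i. if i < K then snd (z i) else x0)"
    proof (rule continuous_on_coordinatewise_then_product)
      show "continuous_on UNIV (\<lambda>z :: nat \<Rightarrow> 'a \<times> 'a. if i < K then snd (z i) else x0)" for i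
        by (cases "i < K") (auto intro!: continuous_intros)
    qed
    then have "limit_measure F (\<lambda>n. distr (Q n) borel (\<lambda>z i. if i < K then snd (z i) else x0))
        (distr R borel (\<lambda>z i. if i < K then snd (z i) else x0))"
      by (rule limit_measure_distr[OF lim Q(2)])
    moreover have "\<forall>\<^sub>F n in F. distr (Q n) borel (\<lambda>z i. if i < K then snd (z i) else x0) = ?\<nu>"
      using evF[of K] by eventually_elim (rule sndQ[rule_format])
    ultimately have "limit_measure F (\<lambda>_. ?\<nu>) (distr R borel (\<lambda>z i. if i < K then snd (z i) else x0))"
      by (rule limit_measure_cong)
    then show ?thesis
      by (rule limit_measure_unique[OF _ limit_measure_const[OF R(3) \<nu>] \<nu>])
  qed
  \<comment> \<open>Once \<open>i < N + n\<close> the coordinate \<open>i\<close> is no longer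
    padding and the bound with error \<open>1 / real (N + n)\<close> applies; the error vanishes
    along \<open>F\<close>.\<close>
  have costR: "(\<integral>\<^sup>+ z. ennreal (c (fst (z i)) (snd (z i))) \<partial>R) \<le> ennreal \<rho>" for i
  proof (rule limit_measure_nn_integral_le[OF lim Q cost_coordinates_lsc(1) cost_nonneg])
    show "\<forall>\<^sub>F n in F. (\<integral>\<^sup>+ z. ennreal (c (fst (z i)) (snd (z i))) \<partial>Q n) \<le> ennreal (\<rho> + 1 / real (N + n))"
      using evF[of "Suc i"] by eventually_elim (rule costQ[rule_format], simp)
    have "((\<lambda>n. \<rho> + 1 / real (N + n)) \<longlongrightarrow> \<rho> + 0) sequentially"
      by (intro tendsto_add tendsto_const, subst add.commute,
          rule LIMSEQ_ignore_initial_segment[OF lim_1_over_n])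
    then show "((\<lambda>n. \<rho> + 1 / real (N + n)) \<longlongrightarrow> \<rho>) F"
      using tendsto_mono[OF F] by simp
  qed
  have momR: "(\<integral>\<^sup>+ z. ennreal (c x0 (fst (z i))) \<partial>R) \<le> ennreal B" for i
    by (rule limit_measure_nn_integral_le[OF lim Q cost_coordinates_lsc(2) cost_nonneg _ tendsto_const])
       (simp add: mom1)
  have mR: "f \<in> measurable R A" if "f \<in> measurable borel A" for f and A :: "'c measure"
    using that measurable_cong_sets[OF R(2) refl] by blast
  have fm: "(\<lambda>z. proj K (fst \<circ> z)) \<in> measurable R (prodX K :: (nat \<Rightarrow> 'a) measure)" for K
    by (rule mR[OF measurable_compose[OF comp_measurable(1) proj_measurable_borel]])
  define P where "P = distr R (prodX N) (\<lambda>z. proj N (fst \<circ> z))"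
  have "P \<in> Uinf c Phat \<rho> N"
    unfolding Uinf_def
  proof
    fix M assume "M \<in> {N..}"
    then have M: "N \<le> M" by simp
    have "distr R (prodX M) (\<lambda>z. proj M (fst \<circ> z)) \<in> wball_sym c Phat \<rho> M"
      by (rule marginal_in_wball_sym[OF R(1,2) permR sndR costR momR])
    \<comment> \<open>Marginals of one law are consistent, so the same \<open>P\<close> arises from
      every \<open>M\<close>.\<close>
    moreover have "P = distr (distr R (prodX M) (\<lambda>z. proj M (fst \<circ> z))) (prodX N) (proj N)"
      unfolding P_def distr_distr[OF proj_measurable[OF M] fm]
      using M by (intro distr_cong) (auto simp: proj_def fun_eq_iff restrict_def)
    ultimately show "P \<in> UM c Phat \<rho> N M"
      unfolding UM_def by blast
  qed
  moreover have "ereal a \<le> expect P loss"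
  proof -
    note limloss = limit_measure_loss[OF lim Q less_imp_le[OF B] mom1 momR loss1 loss2]
    have lm: "loss \<in> borel_measurable (prodX N)"
      by (rule loss_borel_measurable_prodX)
    have "integrable P loss"
      unfolding P_def integrable_distr_eq[OF fm lm] by (rule limloss)
    moreover have "(\<integral>x. loss x \<partial>P) = (\<integral>z. loss (proj N (fst \<circ> z)) \<partial>R)"
      unfolding P_def by (rule integral_distr[OF fm lm])
    ultimately show ?thesis
      using limloss(2) by (simp add: expect_integrable)
  qed
  ultimately show ?thesis by blast
qed

theorem Uinf_duality:
  "(SUP P\<in>Uinf c Phat \<rho> N. expect P loss) = (INF M\<in>{N..}. Usym c Phat \<rho> N M loss)"
proof (rule antisym)
  show "(SUP P\<in>Uinf c Phat \<rho> N. expect P loss) \<le> (INF M\<in>{N..}. Usym c Phat \<rho> N M loss)"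
    by (intro SUP_least INF_greatest expect_UM_le) (auto simp: Uinf_def)
  show "(INF M\<in>{N..}. Usym c Phat \<rho> N M loss) \<le> (SUP P\<in>Uinf c Phat \<rho> N. expect P loss)"
  proof (rule dense_le)
    \<comment> \<open>Inserting a real \<open>a\<close> above \<open>e\<close> treats finite and
      infinite values of the infimum alike.\<close>
    fix e assume e: "e < (INF M\<in>{N..}. Usym c Phat \<rho> N M loss)"
    obtain a where a: "e < ereal a" "ereal a < (INF M\<in>{N..}. Usym c Phat \<rho> N M loss)"
      using ereal_dense2[OF e] by blast
    have "ereal a < Usym c Phat \<rho> N M loss" if "N \<le> M" for M
      by (rule less_INF_D[OF a(2)]) (simp add: that)
    from Uinf_attains_above[OF this]
    obtain P where "P \<in> Uinf c Phat \<rho> N" "ereal a \<le> expect P loss"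
      by blast
    then have "ereal a \<le> (SUP P\<in>Uinf c Phat \<rho> N. expect P loss)"
      by (rule SUP_upper2)
    with a(1) show "e \<le> (SUP P\<in>Uinf c Phat \<rho> N. expect P loss)"
      by simp
  qed
qed

end

theorem mainTheorem11:
  fixes c :: "'a::polish_space \<Rightarrow> 'a \<Rightarrow> real"
    and Phat :: "'a measure"
    and \<rho> :: real and N :: nat
    and loss :: "(nat \<Rightarrow> 'a) \<Rightarrow> real"
  assumes "proper_cost c"
    and "prob_space Phat" and "sets Phat = sets borel"
    and "finite_moment c Phat"
    and "\<rho> > 0" and "N \<ge> 1"
    and "usc_on (prodTop N) loss"
    and "loss \<in> growth_class c N"
  shows "(SUP P\<in>Uinf c Phat \<rho> N. expect P loss) = (INF M\<in>{N..}. Usym c Phat \<rho> N M loss)"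
proof -
  interpret symmetric_transport_ball c Phat \<rho> N loss
    by (rule symmetric_transport_ball.intro) fact+
  show ?thesis
    by (rule Uinf_duality)
qed

end
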